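(* Let $\mathcal G=(\mathcal V,\mathcal E)$ be a dynamic graph on a fixed node set that is updated by a sequence of edge insertions and deletions, and suppose that at all times every node of $\mathcal G$ has degree at most $\Delta$. There is a deterministic dynamic algorithm that maintains a matching $M$ in $\mathcal G$ such that, after every update, every augmenting path in $\mathcal G$ with respect to $M$ has length at least five, and such that each edge insertion and each edge deletion is handled in $O(\Delta)$ worst-case time.
   Context: A matching is a set of pairwise vertex-disjoint edges. Given a matching $M$, an augmenting path of length $2k+1$ ($k\ge 0$) is a simple path with $2k+1$ edges whose two end nodes are both unmatched in $M$ and whose edges alternate between edges not in $M$ and edges in $M$ (the first and last edges are not in $M$). Length is measured in number of edges. *)

theory Defs
  imports Main
begin

text \<open>A graph on node set {0..<n} is given by a set of edges, each a 2-element set.\<close>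

definition matching :: "nat set set \<Rightarrow> bool" where
  "matching M \<longleftrightarrow> (\<forall>e\<in>M. \<forall>f\<in>M. e \<noteq> f \<longrightarrow> e \<inter> f = {})"

definition matched :: "nat set set \<Rightarrow> nat \<Rightarrow> bool" where
  "matched M x \<longleftrightarrow> (\<exists>e\<in>M. x \<in> e)"

definition augmenting_path :: "nat set set \<Rightarrow> nat set set \<Rightarrow> nat list \<Rightarrow> bool" where
  "augmenting_path E M p \<longleftrightarrow>
     odd (length p - 1) \<and> length p \<ge> 2 \<and> distinct p \<and>
     (\<forall>i < length p - 1. {p ! i, p ! Suc i} \<in> E \<and>
                           ({p ! i, p ! Suc i} \<in> M \<longleftrightarrow> odd i)) \<and>
     \<not> matched M (hd p) \<and> \<not> matched M (last p)"

definition path_length :: "nat list \<Rightarrow> nat" where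
  "path_length p = length p - 1"

datatype update = Ins nat nat | Del nat nat

fun apply_update :: "nat set set \<Rightarrow> update \<Rightarrow> nat set set" where
  "apply_update E (Ins u v) = insert {u, v} E"
| "apply_update E (Del u v) = E - {{u, v}}"

definition graph_after :: "update list \<Rightarrow> nat set set" where
  "graph_after us = foldl apply_update {} us"

fun valid_update :: "nat \<Rightarrow> nat set set \<Rightarrow> update \<Rightarrow> bool" where
  "valid_update n E (Ins u v) \<longleftrightarrow> u < n \<and> v < n \<and> u \<noteq> v \<and> {u, v} \<notin> E"
| "valid_update n E (Del u v) \<longleftrightarrow> {u, v} \<in> E"

definition degree :: "nat set set \<Rightarrow> nat \<Rightarrow> nat" where
  "degree E x = card {e \<in> E. x \<in> e}"

definition valid_updates :: "nat \<Rightarrow> nat \<Rightarrow> update list \<Rightarrow> bool" where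
  "valid_updates n \<Delta> us \<longleftrightarrow>
     (\<forall>i < length us. valid_update n (graph_after (take i us)) (us ! i)) \<and>
     (\<forall>i \<le> length us. \<forall>x < n. degree (graph_after (take i us)) x \<le> \<Delta>)"

text \<open>Memory cells indexed by naturals holding naturals; addresses in instructions
  are literal cell indices; indirect access via LoadI/StoreI. Each executed
  instruction costs one time step. No multiplication/shift (to avoid word-size cheating).\<close>

datatype instr =
    LoadC nat nat
  | Add nat nat nat
  | Sub nat nat nat
  | LoadI nat nat
  | StoreI nat nat
  | Jz nat nat
  | Jmp nat
  | Halt

type_synonym conf = "nat \<times> (nat \<Rightarrow> nat)"

definition halted :: "instr list \<Rightarrow> conf \<Rightarrow> bool" where
  "halted P c \<longleftrightarrow> fst c \<ge> length P \<or> P ! fst c = Halt"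

fun exec_instr :: "instr \<Rightarrow> conf \<Rightarrow> conf" where
  "exec_instr (LoadC a k) (pc, m) = (Suc pc, m(a := k))"
| "exec_instr (Add a b c) (pc, m) = (Suc pc, m(a := m b + m c))"
| "exec_instr (Sub a b c) (pc, m) = (Suc pc, m(a := m b - m c))"
| "exec_instr (LoadI a b) (pc, m) = (Suc pc, m(a := m (m b)))"
| "exec_instr (StoreI a b) (pc, m) = (Suc pc, m(m a := m b))"
| "exec_instr (Jz a l) (pc, m) = (if m a = 0 then l else Suc pc, m)"
| "exec_instr (Jmp l) (pc, m) = (l, m)"
| "exec_instr Halt (pc, m) = (pc, m)"

definition step :: "instr list \<Rightarrow> conf \<Rightarrow> conf" where
  "step P c = (if halted P c then c else exec_instr (P ! fst c) c)"

definition exec :: "instr list \<Rightarrow> nat \<Rightarrow> conf \<Rightarrow> conf" where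
  "exec P t c = (step P ^^ t) c"

definition halts_within :: "instr list \<Rightarrow> nat \<Rightarrow> (nat \<Rightarrow> nat) \<Rightarrow> (nat \<Rightarrow> nat) \<Rightarrow> bool" where
  "halts_within P k m m' \<longleftrightarrow>
     (\<exists>t \<le> k. halted P (exec P t (0, m)) \<and> snd (exec P t (0, m)) = m')"

text \<open>Initially all cells are 0 except cell 3, which holds n.
  Before each update the environment writes the update into cells 0,1,2
  (cell 0: 0 = insertion, 1 = deletion; cells 1,2: endpoints).
  The maintained matching is read off the mate array: cell 4+u holds v+1 if
  u is matched to v (and 0 otherwise).\<close>

definition init_mem :: "nat \<Rightarrow> nat \<Rightarrow> nat" where
  "init_mem n = (\<lambda>_. 0)(3 := n)"

fun write_update :: "update \<Rightarrow> (nat \<Rightarrow> nat) \<Rightarrow> (nat \<Rightarrow> nat)" where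
  "write_update (Ins u v) m = m(0 := 0, 1 := u, 2 := v)"
| "write_update (Del u v) m = m(0 := 1, 1 := u, 2 := v)"

definition decode_matching :: "nat \<Rightarrow> (nat \<Rightarrow> nat) \<Rightarrow> nat set set" where
  "decode_matching n m = {{u, v} | u v. u < n \<and> v < n \<and> m (4 + u) = Suc v}"

definition good_matching :: "nat set set \<Rightarrow> nat set set \<Rightarrow> bool" where
  "good_matching E M \<longleftrightarrow> matching M \<and> M \<subseteq> E \<and>
     (\<forall>p. augmenting_path E M p \<longrightarrow> path_length p \<ge> 5)"

end

theory Submission
  imports Defs
begin

text \<open>
  Every node keeps a list of its neighbours and the number of its unmatched neighbours. When a node
  changes between matched and unmatched, the counters of its neighbours are corrected in time
  \<open>O(\<Delta>)\<close>. After an update, every augmenting path of length at most three starts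
  or ends in an end of the updated edge. For such an unmatched end \<open>x\<close>, first lower the
  counters of its neighbours, so that they count the unmatched nodes other than \<open>x\<close>. One
  scan of the neighbours \<open>w\<close> of \<open>x\<close> then finds an unmatched \<open>w\<close>, or a
  matched \<open>w\<close> whose mate has a positive counter; in the second case a scan of the
  neighbours of that mate finds the other end of an augmenting path of length three. A path of length
  three is used only if none of length one exists, so augmenting never creates a new short path.

  When a matched edge is deleted, its two ends are treated one after the other, and the second
  end is hidden (it is its own mate) while the first is treated. Otherwise the first search could
  end in the second node and leave a short augmenting path whose inner edge is new.
\<close>

section \<open>A structured language and its compilation\<close>

text \<open>One fixed program has to serve every \<open>n\<close> and every \<open>\<Delta>\<close>,
  so it cannot reserve \<Delta> slots per node. The table of neighbours therefore grows row by row,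
  and a loop runs over the rows in use, of which there are never more than \<Delta>. No loop
  contains another one, so an update is a constant number of such passes.

  The counters have to leave out \<open>x\<close> because of triangles: if \<open>x\<close> is
  adjacent to both ends of a matched edge, it would otherwise be counted as the far end of a path
  that starts in \<open>x\<close> itself.

  Hiding a node by making it its own mate needs no extra flag. Its mate entry is nonzero, so neither
  the counters nor a scan for unmatched nodes sees it, and it lies on no matched edge that could be
  the middle of a path.\<close>

text \<open>
  Only the cells 0 to 3 can be addressed by literals: the cells from 4 on hold mates, and cell 3
  has to keep \<open>n\<close>. Everything else is reached through an address computed from cell 3, with
  cells 0 to 2 as scratch. Nodes are shifted by one, so that 0 means ``none''. The entry of row
  \<open>j\<close> for \<open>x\<close> is at distance \<open>j * n\<close> from that of row 0; as there is no
  multiplication, the row numbers \<open>Lev i\<close> are stored multiplied by \<open>n\<close>. \<open>Lev 0\<close>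
  is the row of the running loop, and \<open>Lev 1\<close> the number of rows in use.
\<close>

datatype loc = Lev nat | Reg nat | Mate nat | Cnt nat | Adj nat nat

type_synonym state = "loc \<Rightarrow> nat"

fun valid_loc :: "nat \<Rightarrow> loc \<Rightarrow> bool" where
  "valid_loc n (Lev i) \<longleftrightarrow> i < 3"
| "valid_loc n (Reg k) \<longleftrightarrow> k < 11"
| "valid_loc n (Mate x) \<longleftrightarrow> 0 < x \<and> x \<le> n"
| "valid_loc n (Cnt x) \<longleftrightarrow> 0 < x \<and> x \<le> n"
| "valid_loc n (Adj j x) \<longleftrightarrow> 0 < x \<and> x \<le> n"

text \<open>The mate block is dictated by \<open>decode_matching\<close>: node \<open>u\<close> is
  \<open>x = u + 1\<close> here, and cell \<open>4 + u\<close> is \<open>3 + x\<close>. The blocks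
  then follow without gaps: 3 levels, 11 registers, \<open>n\<close> counters, and an unbounded
  table with \<open>n\<close> cells per row.\<close>

fun addr :: "nat \<Rightarrow> loc \<Rightarrow> nat" where
  "addr n (Lev i) = 4 + n + i"
| "addr n (Reg k) = 7 + n + k"
| "addr n (Mate x) = 3 + x"
| "addr n (Cnt x) = 17 + n + x"
| "addr n (Adj j x) = 17 + 2 * n + j * n + x"

fun is_lev :: "loc \<Rightarrow> bool" where
  "is_lev (Lev i) = True"
| "is_lev _ = False"

definition scale :: "nat \<Rightarrow> loc \<Rightarrow> nat" where
  "scale n l = (if is_lev l then n else 1)"

text \<open>Cells 0 to 2 stay unconstrained, which makes them scratch. Table rows are represented
  for every \<open>j\<close>, so taking a new row into use needs no allocation.\<close>

definition rep :: "nat \<Rightarrow> state \<Rightarrow> (nat \<Rightarrow> nat) \<Rightarrow> bool" where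
  "rep n s m \<longleftrightarrow> m 3 = n \<and> (\<forall>l. valid_loc n l \<longrightarrow> m (addr n l) = scale n l * s l)"

text \<open>Division with remainder, the remainders being taken from 1 to \<open>n\<close> because
  nodes are shifted by one.\<close>

lemma row_unique:
  fixes n :: nat
  assumes "i * n + x = j * n + y" "0 < x" "x \<le> n" "0 < y" "y \<le> n"
  shows "i = j"
proof (rule ccontr)
  assume "i \<noteq> j"
  then consider "Suc i \<le> j" | "Suc j \<le> i" by linarith
  then show False
  proof cases
    case 1
    then have "Suc i * n \<le> j * n" by (rule mult_le_mono1)
    then show False using assms by simp
  next
    case 2
    then have "Suc j * n \<le> i * n" by (rule mult_le_mono1)
    then show False using assms by simp
  qed
qed

lemma addr_inj:
  assumes "valid_loc n l" "valid_loc n l'" "addr n l = addr n l'"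
  shows "l = l'"
proof (cases l)
  case (Adj i x)
  show ?thesis
  proof (cases l')
    case (Adj j y)
    with \<open>l = Adj i x\<close> assms have *: "i * n + x = j * n + y" "0 < x" "x \<le> n" "0 < y" "y \<le> n"
      by simp_all
    from row_unique[OF this] *(1) show ?thesis using \<open>l = Adj i x\<close> Adj by simp
  qed (use assms Adj in simp_all)
qed (cases l', use assms in simp_all)+

lemma addr_ge: "valid_loc n l \<Longrightarrow> 4 \<le> addr n l"
  by (cases l) auto

lemma rep_scratch: "rep n s m \<Longrightarrow> a < 3 \<Longrightarrow> rep n s (m(a := v))"
proof -
  assume r: "rep n s m" and a: "a < 3"
  have "(m(a := v)) (addr n l) = m (addr n l)" if "valid_loc n l" for l
    using addr_ge[OF that] a by simp
  then show ?thesis using r a by (simp add: rep_def)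
qed

lemma rep_upd:
  assumes "rep n s m" "valid_loc n l" "w = scale n l * v"
  shows "rep n (s(l := v)) (m(addr n l := w))"
  unfolding rep_def
proof (intro conjI allI impI)
  show "(m(addr n l := w)) 3 = n"
    using assms(1) addr_ge[OF assms(2)] by (auto simp: rep_def)
  fix l' assume "valid_loc n l'"
  then show "(m(addr n l := w)) (addr n l') = scale n l' * (s(l := v)) l'"
    using assms addr_inj[of n l' l] by (auto simp: rep_def)
qed

section \<open>References to locations and the computation of their addresses\<close>

datatype ref = RLev nat | RReg nat | RMate nat | RCnt nat | RAdj nat

text \<open>Nodes are always named through a register, and the row is always \<open>Lev 0\<close>,
  the one that the running loop visits. As this level is stored as a multiple of \<open>n\<close>,
  additions alone yield the address of a table entry.\<close>

fun loc_of :: "state \<Rightarrow> ref \<Rightarrow> loc" where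
  "loc_of s (RLev i) = Lev i"
| "loc_of s (RReg k) = Reg k"
| "loc_of s (RMate k) = Mate (s (Reg k))"
| "loc_of s (RCnt k) = Cnt (s (Reg k))"
| "loc_of s (RAdj k) = Adj (s (Lev 0)) (s (Reg k))"

fun ok :: "nat \<Rightarrow> state \<Rightarrow> ref \<Rightarrow> bool" where
  "ok n s (RLev i) \<longleftrightarrow> i < 3"
| "ok n s (RReg k) \<longleftrightarrow> k < 11"
| "ok n s (RMate k) \<longleftrightarrow> k < 11 \<and> 0 < s (Reg k) \<and> s (Reg k) \<le> n"
| "ok n s (RCnt k) \<longleftrightarrow> k < 11 \<and> 0 < s (Reg k) \<and> s (Reg k) \<le> n"
| "ok n s (RAdj k) \<longleftrightarrow> k < 11 \<and> 0 < s (Reg k) \<and> s (Reg k) \<le> n"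

text \<open>Levels are stored in units of \<open>n\<close>, everything else in units of 1. Values
  may be combined only within the same unit, and this predicate tells the two apart.\<close>

fun rlev :: "ref \<Rightarrow> bool" where
  "rlev (RLev i) = True"
| "rlev _ = False"

lemma ok_valid: "ok n s r \<Longrightarrow> valid_loc n (loc_of s r)"
  by (cases r) auto

lemma scale_loc_of: "scale n (loc_of s r) = (if rlev r then n else 1)"
  by (cases r) (auto simp: scale_def)

definition code_at :: "instr list \<Rightarrow> nat \<Rightarrow> instr list \<Rightarrow> bool" where
  "code_at P pc xs \<longleftrightarrow> (\<exists>as bs. P = as @ xs @ bs \<and> length as = pc)"

lemma code_at_append:
  assumes "code_at P pc (xs @ ys)"
  shows "code_at P pc xs" "code_at P (pc + length xs) ys"
proof -
  obtain as bs where "P = as @ (xs @ ys) @ bs" "length as = pc"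
    using assms unfolding code_at_def by blast
  then have "P = as @ xs @ (ys @ bs)" "P = (as @ xs) @ ys @ bs" "length (as @ xs) = pc + length xs"
    by auto
  then show "code_at P pc xs" "code_at P (pc + length xs) ys"
    unfolding code_at_def using \<open>length as = pc\<close> by blast+
qed

lemma code_at_Cons:
  assumes "code_at P pc (x # xs)"
  shows "pc < length P" "P ! pc = x" "code_at P (Suc pc) xs"
proof -
  obtain as bs where P: "P = as @ x # xs @ bs" and pc: "length as = pc"
    using assms by (auto simp: code_at_def)
  show "pc < length P" "P ! pc = x" using pc unfolding P by auto
  show "code_at P (Suc pc) xs" using code_at_append(2)[of P pc "[x]" xs] assms by simp
qed

lemma exec_comp:
  assumes "exec P t c = c'" "exec P t' c' = c''"
  shows "exec P (t + t') c = c''"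
proof -
  have "exec P (t' + t) c = exec P t' (exec P t c)" by (simp only: exec_def funpow_add o_apply)
  then show ?thesis using assms by (simp only: add.commute[of t t'])
qed

lemma exec_1:
  assumes "code_at P pc (i # is)" "i \<noteq> Halt"
  shows "exec P 1 (pc, m) = exec_instr i (pc, m)"
  using code_at_Cons[OF assms(1)] assms(2) by (simp add: exec_def step_def halted_def)

fun straight :: "instr \<Rightarrow> bool" where
  "straight (Jz a l) = False"
| "straight (Jmp l) = False"
| "straight Halt = False"
| "straight _ = True"

text \<open>A straight instruction changes memory independently of the program counter, so 0 can
  stand in for it.\<close>

fun effects :: "instr list \<Rightarrow> (nat \<Rightarrow> nat) \<Rightarrow> (nat \<Rightarrow> nat)" where
  "effects [] m = m"
| "effects (i # is) m = effects is (snd (exec_instr i (0, m)))"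

lemma effects_append: "effects (xs @ ys) m = effects ys (effects xs m)"
  by (induction xs arbitrary: m) auto

lemma exec_straight:
  assumes "code_at P pc xs" "list_all straight xs"
  shows "exec P (length xs) (pc, m) = (pc + length xs, effects xs m)"
  using assms
proof (induction xs arbitrary: pc m)
  case Nil
  then show ?case by (simp add: exec_def)
next
  case (Cons i xs)
  have "exec_instr i (pc, m) = (Suc pc, snd (exec_instr i (0, m)))"
    using Cons.prems(2) by (cases i) auto
  then have "exec P 1 (pc, m) = (Suc pc, snd (exec_instr i (0, m)))"
    using exec_1[OF Cons.prems(1)] Cons.prems(2) by (cases i) auto
  from exec_comp[OF this Cons.IH[OF code_at_Cons(3)[OF Cons.prems(1)]]]
  show ?case using Cons.prems(2) by simp
qed

text \<open>The address ends up in cell 0 and only cells 0 and 1 are overwritten. Cell 2 can thus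
  carry a value across an address computation; adding cell 3 adds \<open>n\<close>.\<close>

fun code_addr :: "ref \<Rightarrow> instr list" where
  "code_addr (RLev i) = [LoadC 0 (4 + i), Add 0 0 3]"
| "code_addr (RReg k) = [LoadC 0 (7 + k), Add 0 0 3]"
| "code_addr (RMate k) = [LoadC 0 (7 + k), Add 0 0 3, LoadI 0 0, LoadC 1 3, Add 0 0 1]"
| "code_addr (RCnt k) = [LoadC 0 (7 + k), Add 0 0 3, LoadI 0 0, Add 0 0 3, LoadC 1 17, Add 0 0 1]"
| "code_addr (RAdj k) = [LoadC 0 (7 + k), Add 0 0 3, LoadI 0 0, Add 0 0 3, Add 0 0 3, LoadC 1 17,
     Add 0 0 1, LoadC 1 4, Add 1 1 3, LoadI 1 1, Add 0 0 1]"

definition fetch :: "ref \<Rightarrow> instr list" where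
  "fetch r = code_addr r @ [LoadI 0 0]"

lemma straight_code_addr [simp]: "list_all straight (code_addr r)"
  by (cases r) auto

lemma straight_fetch [simp]: "list_all straight (fetch r)"
  by (simp add: fetch_def)

lemma rep_at: "rep n s m \<Longrightarrow> valid_loc n l \<Longrightarrow> m (addr n l) = scale n l * s l"
  by (simp add: rep_def)

lemma rep_reg:
  assumes "rep n s m" "k < 11" shows "m (7 + k + n) = s (Reg k)"
proof -
  have "7 + k + n = addr n (Reg k)" by simp
  then show ?thesis using rep_at[OF assms(1), of "Reg k"] assms(2)
    by (simp only: valid_loc.simps scale_def is_lev.simps if_False mult_1)
qed

lemma rep_lev:
  assumes "rep n s m" "i < 3" shows "m (4 + i + n) = n * s (Lev i)"
proof -
  have "4 + i + n = addr n (Lev i)" by simp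
  then show ?thesis using rep_at[OF assms(1), of "Lev i"] assms(2)
    by (simp only: valid_loc.simps scale_def is_lev.simps if_True)
qed

lemma rep_n: "rep n s m \<Longrightarrow> m 3 = n"
  by (simp add: rep_def)

lemma effects_code_addr:
  assumes "rep n s m" "ok n s r"
  shows "effects (code_addr r) m 0 = addr n (loc_of s r)"
    and "a \<ge> 2 \<Longrightarrow> effects (code_addr r) m a = m a"
    and "rep n s (effects (code_addr r) m)"
proof -
  note [simp] = rep_n[OF assms(1)]
  have lev0: "m (4 + n) = n * s (Lev 0)" using rep_lev[OF assms(1), of 0] by simp
  show "effects (code_addr r) m 0 = addr n (loc_of s r)"
    using assms(2) rep_reg[OF assms(1)] lev0 by (cases r) (auto simp: algebra_simps)
  have frame: "effects (code_addr r) m a = m a" if "a \<ge> 2" for a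
    using that by (cases r) auto
  show "a \<ge> 2 \<Longrightarrow> effects (code_addr r) m a = m a" by (rule frame)
  show "rep n s (effects (code_addr r) m)"
    unfolding rep_def
  proof (intro conjI allI impI)
    show "effects (code_addr r) m 3 = n" by (simp add: frame)
    fix l assume l: "valid_loc n l"
    then have "2 \<le> addr n l" using addr_ge[OF l] by simp
    then show "effects (code_addr r) m (addr n l) = scale n l * s l"
      using assms(1) l frame by (simp add: rep_def)
  qed
qed

lemma effects_fetch:
  assumes "rep n s m" "ok n s r"
  shows "effects (fetch r) m 0 = (if rlev r then n else 1) * s (loc_of s r)"
    and "a \<ge> 2 \<Longrightarrow> effects (fetch r) m a = m a"
    and "rep n s (effects (fetch r) m)"
proof -
  note c = effects_code_addr[OF assms]
  have "effects (code_addr r) m (addr n (loc_of s r)) = scale n (loc_of s r) * s (loc_of s r)"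
    using c(3) ok_valid[OF assms(2)] by (simp add: rep_def)
  then show "effects (fetch r) m 0 = (if rlev r then n else 1) * s (loc_of s r)"
    by (simp add: fetch_def effects_append c(1) scale_loc_of)
  show "a \<ge> 2 \<Longrightarrow> effects (fetch r) m a = m a"
    using c(2) by (simp add: fetch_def effects_append)
  show "rep n s (effects (fetch r) m)"
    using rep_scratch[OF c(3)] by (simp add: fetch_def effects_append)
qed

section \<open>Commands and the machine code generated for them\<close>

datatype com =
    Skip
  | Seq com com  (infixr ";;" 60)
  | Const nat nat
  | Mov ref ref
  | Plus ref ref ref
  | Minus ref ref ref
  | IncLev nat
  | If ref com com
  | Each com

text \<open>The machine cannot copy a cell directly: \<open>LoadC 2 0, Add 2 2 0\<close> moves the
  first operand from cell 0 to cell 2, where it survives the fetch of the second one.\<close>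

definition bin :: "instr \<Rightarrow> ref \<Rightarrow> ref \<Rightarrow> ref \<Rightarrow> instr list" where
  "bin i r a b = fetch a @ [LoadC 2 0, Add 2 2 0] @ fetch b @ [i] @ code_addr r @ [StoreI 0 2]"

definition mov :: "ref \<Rightarrow> ref \<Rightarrow> instr list" where
  "mov r a = fetch a @ [LoadC 2 0, Add 2 2 0] @ code_addr r @ [StoreI 0 2]"

definition inc_code :: "nat \<Rightarrow> instr list" where
  "inc_code i = fetch (RLev i) @ [LoadC 2 0, Add 2 2 0, Add 2 2 3] @ code_addr (RLev i) @ [StoreI 0 2]"

definition dec_code :: "nat \<Rightarrow> instr list" where
  "dec_code i = fetch (RLev i) @ [LoadC 2 0, Add 2 2 0, Sub 2 2 3] @ code_addr (RLev i) @ [StoreI 0 2]"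

definition const_code :: "nat \<Rightarrow> nat \<Rightarrow> instr list" where
  "const_code k v = [LoadC 2 v] @ code_addr (RReg k) @ [StoreI 0 2]"

lemma store_back:
  assumes "rep n s m" "ok n s r" "m 2 = (if rlev r then n else 1) * v"
  shows "rep n (s(loc_of s r := v)) (effects (code_addr r @ [StoreI 0 2]) m)"
proof -
  note c = effects_code_addr[OF assms(1,2)]
  have "rep n (s(loc_of s r := v)) ((effects (code_addr r) m)(addr n (loc_of s r) := m 2))"
    by (rule rep_upd[OF c(3) ok_valid[OF assms(2)]]) (simp only: assms(3) scale_loc_of)
  moreover have "effects (code_addr r @ [StoreI 0 2]) m = (effects (code_addr r) m)(addr n (loc_of s r) := m 2)"
    by (simp only: effects_append effects.simps exec_instr.simps snd_conv c(1) c(2)[OF order_refl])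
  ultimately show ?thesis by simp
qed

text \<open>Multiplication by \<open>n\<close> distributes over sums and over truncated differences,
  so arithmetic on the stored multiples mirrors arithmetic on the row numbers.\<close>

lemma rep_bin:
  assumes "rep n s m" "ok n s r" "ok n s a" "ok n s b"
    and "i = Add 2 2 0 \<and> f = (+) \<or> i = Sub 2 2 0 \<and> f = (-)"
    and "rlev r = rlev a" "rlev r = rlev b"
  shows "rep n (s(loc_of s r := f (s (loc_of s a)) (s (loc_of s b)))) (effects (bin i r a b) m)"
proof -
  note f1 = effects_fetch[OF assms(1,3)]
  define m1 where "m1 = effects [LoadC 2 0, Add 2 2 0] (effects (fetch a) m)"
  have "rep n s m1" using f1(3) by (simp add: m1_def rep_scratch)
  note f2 = effects_fetch[OF this assms(4)]
  define m2 where "m2 = effects [i] (effects (fetch b) m1)"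
  have r2: "rep n s m2" using f2(3) assms(5) by (auto simp: m2_def rep_scratch)
  have "m1 2 = (if rlev r then n else 1) * s (loc_of s a)"
    by (simp add: m1_def f1(1) assms(6))
  then have "m2 2 = (if rlev r then n else 1) * f (s (loc_of s a)) (s (loc_of s b))"
    using assms(5) f2(1) f2(2)[of 2] assms(7)
    by (auto simp: m2_def distrib_left diff_mult_distrib2)
  from store_back[OF r2 assms(2) this] show ?thesis
    by (simp only: bin_def effects_append m2_def m1_def loc_of.simps)
qed

lemma rep_mov:
  assumes "rep n s m" "ok n s r" "ok n s a" "rlev r = rlev a"
  shows "rep n (s(loc_of s r := s (loc_of s a))) (effects (mov r a) m)"
proof -
  note f1 = effects_fetch[OF assms(1,3)]
  define m1 where "m1 = effects [LoadC 2 0, Add 2 2 0] (effects (fetch a) m)"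
  have r1: "rep n s m1" using f1(3) by (simp add: m1_def rep_scratch)
  have "m1 2 = (if rlev r then n else 1) * s (loc_of s a)"
    by (simp add: m1_def f1(1) assms(4))
  from store_back[OF r1 assms(2) this] show ?thesis
    by (simp only: mov_def effects_append m1_def loc_of.simps)
qed

lemma rep_lev_step:
  assumes "rep n s m" "i < 3"
  shows "rep n (s(Lev i := Suc (s (Lev i)))) (effects (inc_code i) m)"
    and "rep n (s(Lev i := s (Lev i) - 1)) (effects (dec_code i) m)"
proof -
  have ok: "ok n s (RLev i)" using assms(2) by simp
  note f1 = effects_fetch[OF assms(1) ok]
  have n: "effects (fetch (RLev i)) m 3 = n" using f1(3) by (rule rep_n)
  define m1 where "m1 = effects [LoadC 2 0, Add 2 2 0, Add 2 2 3] (effects (fetch (RLev i)) m)"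
  have r1: "rep n s m1" using f1(3) by (simp add: m1_def rep_scratch)
  have "m1 2 = (if rlev (RLev i) then n else 1) * Suc (s (Lev i))"
    using f1(1) by (simp add: m1_def n)
  from store_back[OF r1 ok this] show "rep n (s(Lev i := Suc (s (Lev i)))) (effects (inc_code i) m)"
    by (simp only: inc_code_def effects_append m1_def loc_of.simps)
  define m2 where "m2 = effects [LoadC 2 0, Add 2 2 0, Sub 2 2 3] (effects (fetch (RLev i)) m)"
  have r2: "rep n s m2" using f1(3) by (simp add: m2_def rep_scratch)
  have "m2 2 = (if rlev (RLev i) then n else 1) * (s (Lev i) - 1)"
    using f1(1) by (simp add: m2_def n diff_mult_distrib2)
  from store_back[OF r2 ok this] show "rep n (s(Lev i := s (Lev i) - 1)) (effects (dec_code i) m)"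
    by (simp only: dec_code_def effects_append m2_def loc_of.simps)
qed

lemma rep_const:
  assumes "rep n s m" "k < 11"
  shows "rep n (s(Reg k := v)) (effects (const_code k v) m)"
  using store_back[OF rep_scratch[OF assms(1)], of 2 "RReg k" v v] assms(2)
  by (simp add: const_code_def effects_append)

text \<open>The length of the code does not depend on where it is placed, so jump targets are known
  before the parts are compiled.\<close>

fun clen :: "com \<Rightarrow> nat" where
  "clen Skip = 0"
| "clen (c ;; d) = clen c + clen d"
| "clen (Const k v) = length (const_code k v)"
| "clen (Mov r a) = length (mov r a)"
| "clen (Plus r a b) = length (bin (Add 2 2 0) r a b)"
| "clen (Minus r a b) = length (bin (Sub 2 2 0) r a b)"
| "clen (IncLev i) = length (inc_code i)"
| "clen (If r c d) = length (fetch r) + clen c + clen d + 2"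
| "clen (Each c) = length (mov (RLev 0) (RLev 1)) + length (fetch (RLev 0)) + length (dec_code 0)
     + clen c + 2"

fun compile :: "nat \<Rightarrow> com \<Rightarrow> instr list" where
  "compile pc Skip = []"
| "compile pc (c ;; d) = compile pc c @ compile (pc + clen c) d"
| "compile pc (Const k v) = const_code k v"
| "compile pc (Mov r a) = mov r a"
| "compile pc (Plus r a b) = bin (Add 2 2 0) r a b"
| "compile pc (Minus r a b) = bin (Sub 2 2 0) r a b"
| "compile pc (IncLev i) = inc_code i"
| "compile pc (If r c d) =
     (let p = pc + length (fetch r) + 1; q = p + clen c + 1 in
      fetch r @ [Jz 0 q] @ compile p c @ [Jmp (q + clen d)] @ compile q d)"
| "compile pc (Each c) =
     (let p = pc + length (mov (RLev 0) (RLev 1)); q = p + length (fetch (RLev 0)) + 1;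
          r = q + length (dec_code 0) in
      mov (RLev 0) (RLev 1) @ fetch (RLev 0) @ [Jz 0 (r + clen c + 1)] @ dec_code 0 @
      compile r c @ [Jmp p])"

lemma length_compile [simp]: "length (compile pc c) = clen c"
  by (induction c arbitrary: pc) (auto simp: Let_def)

text \<open>A bound read off the syntax: both branches of a conditional are charged, and each loop
  is charged for \<open>h\<close> rounds, where \<open>h\<close> bounds the number of rows in
  use.\<close>

fun cost :: "nat \<Rightarrow> com \<Rightarrow> nat" where
  "cost h (c ;; d) = cost h c + cost h d"
| "cost h (If r c d) = length (fetch r) + cost h c + cost h d + 2"
| "cost h (Each c) = length (mov (RLev 0) (RLev 1)) + length (fetch (RLev 0)) + 1 +
     h * (length (fetch (RLev 0)) + length (dec_code 0) + cost h c + 2)"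
| "cost h c = clen c"

text \<open>Row \<open>j\<close> counts down, and the body must leave it alone.\<close>

primrec iter_wp :: "((state \<Rightarrow> bool) \<Rightarrow> state \<Rightarrow> bool) \<Rightarrow> nat \<Rightarrow> (state \<Rightarrow> bool) \<Rightarrow> state \<Rightarrow> bool" where
  "iter_wp W 0 Q s = Q s"
| "iter_wp W (Suc j) Q s = W (\<lambda>s'. s' (Lev 0) = j \<and> iter_wp W j Q s') (s(Lev 0 := j))"

text \<open>Besides the effect, the precondition demands all that the generated code relies on:
  nodes in range, matching units, and at most \<open>h\<close> rounds per loop. One judgement
  thereby yields both functional correctness and the time bound.\<close>

primrec wp :: "nat \<Rightarrow> nat \<Rightarrow> com \<Rightarrow> (state \<Rightarrow> bool) \<Rightarrow> state \<Rightarrow> bool" where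
  "wp n h Skip = (\<lambda>Q. Q)"
| "wp n h (c ;; d) = (\<lambda>Q. wp n h c (wp n h d Q))"
| "wp n h (Const k v) = (\<lambda>Q s. k < 11 \<and> Q (s(Reg k := v)))"
| "wp n h (Mov r a) = (\<lambda>Q s. ok n s r \<and> ok n s a \<and> rlev r = rlev a \<and>
     Q (s(loc_of s r := s (loc_of s a))))"
| "wp n h (Plus r a b) = (\<lambda>Q s. ok n s r \<and> ok n s a \<and> ok n s b \<and> rlev r = rlev a \<and> rlev r = rlev b \<and>
     Q (s(loc_of s r := s (loc_of s a) + s (loc_of s b))))"
| "wp n h (Minus r a b) = (\<lambda>Q s. ok n s r \<and> ok n s a \<and> ok n s b \<and> rlev r = rlev a \<and> rlev r = rlev b \<and>
     Q (s(loc_of s r := s (loc_of s a) - s (loc_of s b))))"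
| "wp n h (IncLev i) = (\<lambda>Q s. i < 3 \<and> Q (s(Lev i := Suc (s (Lev i)))))"
| "wp n h (If r c d) = (\<lambda>Q s. ok n s r \<and>
     (if s (loc_of s r) \<noteq> 0 then wp n h c Q s else wp n h d Q s))"
| "wp n h (Each c) = (\<lambda>Q s. s (Lev 1) \<le> h \<and>
     iter_wp (wp n h c) (s (Lev 1)) Q (s(Lev 0 := s (Lev 1))))"

lemma exec_Jz:
  assumes "code_at P pc (Jz a l # is)"
  shows "exec P 1 (pc, m) = (if m a = 0 then l else Suc pc, m)"
  using exec_1[OF assms] by simp

lemma exec_Jmp:
  assumes "code_at P pc (Jmp l # is)"
  shows "exec P 1 (pc, m) = (l, m)"
  using exec_1[OF assms] by simp

lemma straight_codes [simp]:
  "list_all straight (mov r a)" "list_all straight (inc_code i)" "list_all straight (dec_code i)"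
  "list_all straight (const_code k v)"
  "straight i' \<Longrightarrow> list_all straight (bin i' r a b)"
  by (simp_all add: mov_def inc_code_def dec_code_def const_code_def bin_def)

lemma exec_effects:
  assumes "code_at P pc xs" "list_all straight xs" "rep n s' (effects xs m)" "Q s'"
  shows "\<exists>t m' s'. t \<le> length xs \<and> exec P t (pc, m) = (pc + length xs, m') \<and> rep n s' m' \<and> Q s'"
  by (intro exI conjI, rule order_refl, rule exec_straight[OF assms(1,2)]) (fact assms(3), fact assms(4))

text \<open>Only steps up to the end of the block are counted, so the bounds of consecutive blocks
  add up. \<open>Q\<close> is a parameter of the induction because the first part of a sequence is
  run with the precondition of the second as its goal.\<close>

lemma compile_correct:
  assumes "0 < n" "code_at P pc (compile pc c)" "rep n s m" "wp n h c Q s"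
  shows "\<exists>t m' s'. t \<le> cost h c \<and> exec P t (pc, m) = (pc + clen c, m') \<and> rep n s' m' \<and> Q s'"
  using assms(2-)
proof (induction c arbitrary: pc s m Q)
  case Skip
  then show ?case by (intro exI[of _ 0] exI[of _ m] exI[of _ s]) (simp add: exec_def)
next
  case (Seq c d)
  note code = code_at_append[OF Seq.prems(1)[unfolded compile.simps], unfolded length_compile]
  have "wp n h c (wp n h d Q) s" using Seq.prems(3) by simp
  from Seq.IH(1)[OF code(1) Seq.prems(2) this]
  obtain t m' s' where 1: "t \<le> cost h c" "exec P t (pc, m) = (pc + clen c, m')" "rep n s' m'"
    "wp n h d Q s'" by blast
  from Seq.IH(2)[OF code(2) 1(3,4)]
  obtain t' m'' s'' where 2: "t' \<le> cost h d"
    "exec P t' (pc + clen c, m') = (pc + clen c + clen d, m'')" "rep n s'' m''" "Q s''" by auto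
  show ?case using exec_comp[OF 1(2) 2(2)] 1(1) 2
    by (intro exI[of _ "t + t'"] exI[of _ m''] exI[of _ s'']) (simp add: add.assoc add_mono)
next
  case (Const k v)
  then show ?case using exec_effects[of P pc "const_code k v" n _ m Q] rep_const[of n s m k v] by simp
next
  case (Mov r a)
  then show ?case using exec_effects[of P pc "mov r a" n _ m Q] rep_mov[of n s m r a] by simp
next
  case (Plus r a b)
  then have "rep n (s(loc_of s r := s (loc_of s a) + s (loc_of s b))) (effects (bin (Add 2 2 0) r a b) m)"
    by (intro rep_bin) auto
  with Plus show ?case using exec_effects[of P pc "bin (Add 2 2 0) r a b" n _ m Q] by simp
next
  case (Minus r a b)
  then have "rep n (s(loc_of s r := s (loc_of s a) - s (loc_of s b))) (effects (bin (Sub 2 2 0) r a b) m)"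
    by (intro rep_bin) auto
  with Minus show ?case using exec_effects[of P pc "bin (Sub 2 2 0) r a b" n _ m Q] by simp
next
  case (IncLev i)
  then show ?case using exec_effects[of P pc "inc_code i" n _ m Q] rep_lev_step(1)[of n s m i] by simp
next
  case (If r c d)
  define p where "p = pc + length (fetch r) + 1"
  define q where "q = p + clen c + 1"
  define l where "l = q + clen d"
  have code: "code_at P pc (fetch r @ [Jz 0 q] @ compile p c @ [Jmp l] @ compile q d)"
    using If.prems(1) by (simp add: p_def q_def l_def Let_def)
  note c1 = code_at_append[OF code]
  note c2 = code_at_append[OF c1(2)]
  note c3 = code_at_append[OF c2(2)]
  note c4 = code_at_append[OF c3(2)]
  have cd: "code_at P pc (fetch r)" "code_at P (pc + length (fetch r)) [Jz 0 q]"
    "code_at P p (compile p c)" "code_at P (p + clen c) [Jmp l]" "code_at P q (compile q d)"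
    using c1 c2 c3 c4 by (simp_all add: p_def q_def)
  have ok: "ok n s r" using If.prems(3) by simp
  define m1 where "m1 = effects (fetch r) m"
  have m1: "m1 0 = (if rlev r then n else 1) * s (loc_of s r)" "rep n s m1"
    unfolding m1_def using effects_fetch(1,3)[OF If.prems(2) ok] by auto
  have e1: "exec P (length (fetch r) + 1) (pc, m) = (if m1 0 = 0 then q else p, m1)"
    using exec_comp[OF exec_straight[OF cd(1)] exec_Jz[OF cd(2)]] by (simp add: m1_def p_def)
  \<comment> \<open>A level is stored as a multiple of \<open>n\<close>. With \<open>0 < n\<close>
    the machine's test for zero agrees with the test on the state.\<close>
  have zero: "m1 0 = 0 \<longleftrightarrow> s (loc_of s r) = 0" using m1(1) assms(1) by auto
  have end': "l = pc + clen (If r c d)" by (simp add: l_def q_def p_def)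
  show ?case
  proof (cases "s (loc_of s r) = 0")
    case True
    then have "wp n h d Q s" using If.prems(3) by simp
    from If.IH(2)[OF cd(5) m1(2) this]
    obtain t m' s' where *: "t \<le> cost h d" "exec P t (q, m1) = (q + clen d, m')" "rep n s' m'" "Q s'"
      by auto
    have "exec P (length (fetch r) + 1 + t) (pc, m) = (l, m')"
      using exec_comp[OF e1] *(2) True zero by (simp add: l_def)
    then show ?thesis unfolding end' using *
      by (intro exI[of _ "length (fetch r) + 1 + t"] exI[of _ m'] exI[of _ s']) simp
  next
    case False
    then have "wp n h c Q s" using If.prems(3) by simp
    from If.IH(1)[OF cd(3) m1(2) this]
    obtain t m' s' where *: "t \<le> cost h c" "exec P t (p, m1) = (p + clen c, m')" "rep n s' m'" "Q s'"
      by auto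
    have "exec P (length (fetch r) + 1 + t) (pc, m) = (p + clen c, m')"
      using exec_comp[OF e1] *(2) False zero by simp
    from exec_comp[OF this exec_Jmp[OF cd(4)]]
    show ?thesis unfolding end' using *
      by (intro exI[of _ "length (fetch r) + 1 + t + 1"] exI[of _ m'] exI[of _ s']) simp
  qed
next
  case (Each c)
  define p where "p = pc + length (mov (RLev 0) (RLev 1))"
  define q where "q = p + length (fetch (RLev 0)) + 1"
  define r where "r = q + length (dec_code 0)"
  define l where "l = r + clen c + 1"
  have code: "code_at P pc (mov (RLev 0) (RLev 1) @ fetch (RLev 0) @ [Jz 0 l] @ dec_code 0 @
      compile r c @ [Jmp p])"
    using Each.prems(1) by (simp add: p_def q_def r_def l_def Let_def)
  note c1 = code_at_append[OF code]
  note c2 = code_at_append[OF c1(2)]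
  note c3 = code_at_append[OF c2(2)]
  note c4 = code_at_append[OF c3(2)]
  note c5 = code_at_append[OF c4(2)]
  have cd: "code_at P pc (mov (RLev 0) (RLev 1))" "code_at P p (fetch (RLev 0))"
    "code_at P (p + length (fetch (RLev 0))) [Jz 0 l]" "code_at P q (dec_code 0)"
    "code_at P r (compile r c)" "code_at P (r + clen c) [Jmp p]"
    using c1 c2 c3 c4 c5 by (simp_all add: p_def q_def r_def)
  have end': "l = pc + clen (Each c)" by (simp add: l_def r_def q_def p_def)
  let ?F = "length (fetch (RLev 0))"
  let ?B = "?F + length (dec_code 0) + cost h c + 2"
  \<comment> \<open>Counted from the loop head \<open>p\<close>: a full round, with its test,
    decrement, body and jump back, takes at most \<open>?B\<close> steps, and the last test takes
    \<open>?F + 1\<close>.\<close>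
  have loop: "\<exists>t m' s'. t \<le> ?F + 1 + j * ?B \<and> exec P t (p, m) = (l, m') \<and> rep n s' m' \<and> Q s'"
    if "rep n s m" "s (Lev 0) = j" "iter_wp (wp n h c) j Q s" for j s m
    using that
  proof (induction j arbitrary: s m)
    case 0
    note f = effects_fetch[OF 0(1), of "RLev 0"]
    have "exec P (?F + 1) (p, m) = (l, effects (fetch (RLev 0)) m)"
      using exec_comp[OF exec_straight[OF cd(2)] exec_Jz[OF cd(3)]] f(1) 0(2) by simp
    then show ?case using f(3) 0(3)
      by (intro exI[of _ "?F + 1"] exI[of _ "effects (fetch (RLev 0)) m"] exI[of _ s]) simp
  next
    case (Suc j)
    define m1 where "m1 = effects (fetch (RLev 0)) m"
    have m1: "m1 0 = n * Suc j" "rep n s m1"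
      unfolding m1_def using effects_fetch(1,3)[OF Suc.prems(1), of "RLev 0"] Suc.prems(2) by auto
    have e1: "exec P (?F + 1) (p, m) = (q, m1)"
      using exec_comp[OF exec_straight[OF cd(2)] exec_Jz[OF cd(3)]] m1(1) assms(1)
      by (simp add: m1_def q_def)
    define m2 where "m2 = effects (dec_code 0) m1"
    have r2: "rep n (s(Lev 0 := j)) m2"
      unfolding m2_def using rep_lev_step(2)[OF m1(2), of 0] Suc.prems(2) by simp
    have e2: "exec P (?F + 1 + length (dec_code 0)) (p, m) = (r, m2)"
      using exec_comp[OF e1 exec_straight[OF cd(4)]] by (simp add: m2_def r_def)
    have "wp n h c (\<lambda>s'. s' (Lev 0) = j \<and> iter_wp (wp n h c) j Q s') (s(Lev 0 := j))"
      using Suc.prems(3) by (simp only: iter_wp.simps)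
    from Each.IH[OF cd(5) r2 this]
    obtain t m3 s3 where 3: "t \<le> cost h c" "exec P t (r, m2) = (r + clen c, m3)" "rep n s3 m3"
      "s3 (Lev 0) = j" "iter_wp (wp n h c) j Q s3" by blast
    from Suc.IH[OF 3(3-5)] obtain t' m' s' where
      4: "t' \<le> ?F + 1 + j * ?B" "exec P t' (p, m3) = (l, m')" "rep n s' m'" "Q s'" by blast
    have "exec P (?F + 1 + length (dec_code 0) + t + 1 + t') (p, m) = (l, m')"
      using exec_comp[OF exec_comp[OF exec_comp[OF e2 3(2)] exec_Jmp[OF cd(6)]] 4(2)] .
    then show ?case using 3(1) 4
      by (intro exI[of _ "?F + 1 + length (dec_code 0) + t + 1 + t'"] exI[of _ m'] exI[of _ s']) simp
  qed
  define m0 where "m0 = effects (mov (RLev 0) (RLev 1)) m"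
  have r0: "rep n (s(Lev 0 := s (Lev 1))) m0"
    unfolding m0_def using rep_mov[OF Each.prems(2), of "RLev 0" "RLev 1"] by simp
  have e0: "exec P (length (mov (RLev 0) (RLev 1))) (pc, m) = (p, m0)"
    using exec_straight[OF cd(1)] by (simp add: m0_def p_def)
  have h: "s (Lev 1) \<le> h" and it: "iter_wp (wp n h c) (s (Lev 1)) Q (s(Lev 0 := s (Lev 1)))"
    using Each.prems(3) by auto
  from loop[OF r0 _ it] obtain t m' s' where
    1: "t \<le> ?F + 1 + s (Lev 1) * ?B" "exec P t (p, m0) = (l, m')" "rep n s' m'" "Q s'" by auto
  have "s (Lev 1) * ?B \<le> h * ?B" using h by (rule mult_le_mono1)
  then show ?case unfolding end' [symmetric] using exec_comp[OF e0 1(2)] 1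
    by (intro exI[of _ "length (mov (RLev 0) (RLev 1)) + t"] exI[of _ m'] exI[of _ s']) simp
qed

section \<open>Linear running time of commands without nested loops\<close>

fun loop_free :: "com \<Rightarrow> bool" where
  "loop_free (c ;; d) \<longleftrightarrow> loop_free c \<and> loop_free d"
| "loop_free (If r c d) \<longleftrightarrow> loop_free c \<and> loop_free d"
| "loop_free (Each c) \<longleftrightarrow> False"
| "loop_free c \<longleftrightarrow> True"

fun unnested :: "com \<Rightarrow> bool" where
  "unnested (c ;; d) \<longleftrightarrow> unnested c \<and> unnested d"
| "unnested (If r c d) \<longleftrightarrow> unnested c \<and> unnested d"
| "unnested (Each c) \<longleftrightarrow> loop_free c"
| "unnested c \<longleftrightarrow> True"

lemma cost_loop_free: "loop_free c \<Longrightarrow> cost h c = cost 0 c"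
  by (induction c) (simp_all only: cost.simps loop_free.simps)

lemma cost_linear_loop_free: "loop_free c \<Longrightarrow> \<exists>k. \<forall>h. cost h c \<le> k * (h + 1)"
proof (intro exI allI)
  fix h assume "loop_free c"
  then have "cost h c = cost 0 c * 1" using cost_loop_free[of c h] by simp
  also have "\<dots> \<le> cost 0 c * (h + 1)" by (rule mult_le_mono2) simp
  finally show "cost h c \<le> cost 0 c * (h + 1)" .
qed

text \<open>The body of a loop contains no loop, so its cost is a constant independent of
  \<open>h\<close>, and the cost of the loop is affine in \<open>h\<close>.\<close>

lemma cost_linear: "unnested c \<Longrightarrow> \<exists>k. \<forall>h. cost h c \<le> k * (h + 1)"
proof (induction c)
  case (Seq c d)
  then obtain k k' where *: "\<And>h. cost h c \<le> k * (h + 1)" "\<And>h. cost h d \<le> k' * (h + 1)" by auto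
  have "cost h (c ;; d) \<le> (k + k') * (h + 1)" for h
    using add_mono[OF *(1)[of h] *(2)[of h]] by (simp only: cost.simps add_mult_distrib)
  then show ?case by blast
next
  case (If r c d)
  then obtain k k' where *: "\<And>h. cost h c \<le> k * (h + 1)" "\<And>h. cost h d \<le> k' * (h + 1)" by auto
  have "cost h (If r c d) \<le> (length (fetch r) + 2 + k + k') * (h + 1)" for h
  proof -
    have "cost h (If r c d) = (length (fetch r) + 2) * 1 + (cost h c + cost h d)" by simp
    also have "\<dots> \<le> (length (fetch r) + 2) * (h + 1) + (k * (h + 1) + k' * (h + 1))"
      by (intro add_mono mult_le_mono2 *) simp
    finally show ?thesis by (simp only: add_mult_distrib add.assoc)
  qed
  then show ?case by blast
next
  case (Each c)
  define B where "B = length (fetch (RLev 0)) + length (dec_code 0) + cost 0 c + 2"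
  define A where "A = length (mov (RLev 0) (RLev 1)) + length (fetch (RLev 0)) + 1"
  have "cost h (Each c) = A + h * B" for h
    using Each.prems cost_loop_free[of c h] by (simp add: A_def B_def)
  then have "cost h (Each c) \<le> (A + B) * (h + 1)" for h
    by (simp add: algebra_simps)
  then show ?case by blast
qed (rule cost_linear_loop_free, simp only: loop_free.simps)+

lemma iter_wp_mono:
  assumes "\<And>Q Q' s. (\<And>s. Q s \<Longrightarrow> Q' s) \<Longrightarrow> W Q s \<Longrightarrow> W Q' s"
    and "\<And>s. Q s \<Longrightarrow> Q' s" "iter_wp W j Q s"
  shows "iter_wp W j Q' s"
  using assms(3)
proof (induction j arbitrary: s)
  case (Suc j)
  have "W (\<lambda>s'. s' (Lev 0) = j \<and> iter_wp W j Q s') (s(Lev 0 := j))" using Suc.prems by simp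
  then have "W (\<lambda>s'. s' (Lev 0) = j \<and> iter_wp W j Q' s') (s(Lev 0 := j))"
    by (rule assms(1)[rotated]) (use Suc.IH in blast)
  then show ?case by (simp only: iter_wp.simps)
qed (use assms(2) in auto)

lemma wp_mono: "wp n h c Q s \<Longrightarrow> (\<And>s. Q s \<Longrightarrow> Q' s) \<Longrightarrow> wp n h c Q' s"
proof (induction c arbitrary: Q Q' s)
  case (Seq c d)
  have "\<And>s. wp n h d Q s \<Longrightarrow> wp n h d Q' s" using Seq.IH(2) Seq.prems(2) by blast
  then show ?case using Seq.IH(1) Seq.prems(1) by simp
next
  case (If r c d)
  have "wp n h c Q s \<Longrightarrow> wp n h c Q' s" "wp n h d Q s \<Longrightarrow> wp n h d Q' s"
    using If.IH If.prems(2) by blast+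
  then show ?case using If.prems(1) by auto
next
  case (Each c)
  show ?case using Each.prems iter_wp_mono[of "wp n h c" Q Q'] Each.IH by auto
qed auto

text \<open>The loop runs downwards, so \<open>I j\<close> describes the moment at which exactly the
  rows from \<open>j\<close> on have been visited. The body has to return with \<open>Lev 0\<close>
  unchanged.\<close>

lemma wp_Each:
  assumes "s (Lev 1) \<le> h" "I (s (Lev 1)) (s(Lev 0 := s (Lev 1)))"
    and step: "\<And>j t. j < s (Lev 1) \<Longrightarrow> I (Suc j) t \<Longrightarrow>
      wp n h c (\<lambda>t'. t' (Lev 0) = j \<and> I j t') (t(Lev 0 := j))"
    and "\<And>t. I 0 t \<Longrightarrow> Q t"
  shows "wp n h (Each c) Q s"
proof -
  have "iter_wp (wp n h c) j Q t" if "I j t" "j \<le> s (Lev 1)" for j t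
    using that
  proof (induction j arbitrary: t)
    case (Suc j)
    then show ?case by (auto intro!: wp_mono[OF step[of j t]] Suc.IH)
  qed (use assms(4) in auto)
  then show ?thesis using assms(1,2) by simp
qed

section \<open>Short augmenting paths in terms of mates\<close>

definition wf_nb :: "nat \<Rightarrow> (nat \<Rightarrow> nat set) \<Rightarrow> bool" where
  "wf_nb n nb \<longleftrightarrow> (\<forall>x y. y \<in> nb x \<longrightarrow> x \<in> nb y \<and> 0 < x \<and> x \<le> n \<and> x \<noteq> y)"

definition mates_ok :: "nat \<Rightarrow> (nat \<Rightarrow> nat set) \<Rightarrow> (nat \<Rightarrow> nat) \<Rightarrow> bool" where
  "mates_ok n nb mt \<longleftrightarrow>
     (\<forall>x. 0 < x \<and> x \<le> n \<and> mt x \<noteq> 0 \<and> mt x \<noteq> x \<longrightarrow> mt x \<in> nb x \<and> mt (mt x) = x)"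

text \<open>A node that is its own mate counts as removed from the graph.\<close>

definition no_short :: "(nat \<Rightarrow> nat set) \<Rightarrow> (nat \<Rightarrow> nat) \<Rightarrow> nat set \<Rightarrow> bool" where
  "no_short nb mt S \<longleftrightarrow>
     (\<forall>a d. d \<in> nb a \<and> mt a = 0 \<and> mt d = 0 \<longrightarrow> a \<in> S \<or> d \<in> S) \<and>
     (\<forall>a b d. b \<in> nb a \<and> mt a = 0 \<and> mt b \<noteq> 0 \<and> mt b \<noteq> b \<and> d \<in> nb (mt b) \<and> mt d = 0 \<and> a \<noteq> d \<longrightarrow>
        a \<in> S \<or> d \<in> S)"

lemma wf_nbD: "wf_nb n nb \<Longrightarrow> y \<in> nb x \<Longrightarrow> x \<in> nb y \<and> 0 < x \<and> x \<le> n \<and> 0 < y \<and> y \<le> n \<and> x \<noteq> y"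
  unfolding wf_nb_def by blast

lemma wf_nb_finite: "wf_nb n nb \<Longrightarrow> finite (nb x)"
  using wf_nbD[of n nb _ x] by (auto intro: finite_subset[of _ "{..n}"])

lemma mates_okD: "mates_ok n nb mt \<Longrightarrow> 0 < x \<Longrightarrow> x \<le> n \<Longrightarrow> mt x \<noteq> 0 \<Longrightarrow> mt x \<noteq> x \<Longrightarrow>
    mt x \<in> nb x \<and> mt (mt x) = x"
  unfolding mates_ok_def by blast

lemma no_short1: "no_short nb mt S \<Longrightarrow> d \<in> nb a \<Longrightarrow> mt a = 0 \<Longrightarrow> mt d = 0 \<Longrightarrow> a \<in> S \<or> d \<in> S"
  unfolding no_short_def by blast

lemma no_short3: "no_short nb mt S \<Longrightarrow> b \<in> nb a \<Longrightarrow> mt a = 0 \<Longrightarrow> mt b \<noteq> 0 \<Longrightarrow> mt b \<noteq> b \<Longrightarrow>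
    d \<in> nb (mt b) \<Longrightarrow> mt d = 0 \<Longrightarrow> a \<noteq> d \<Longrightarrow> a \<in> S \<or> d \<in> S"
  unfolding no_short_def by blast

lemma mates_range:
  assumes "wf_nb n nb" "mates_ok n nb mt" "0 < x" "x \<le> n"
  shows "mt x \<le> n"
  using wf_nbD[OF assms(1), of "mt x" x] mates_okD[OF assms(2-4)] assms(4)
  by (cases "mt x = 0"; cases "mt x = x") auto

text \<open>No node becomes unmatched, so a new short path would need the new edge as its middle.
  One of its ends would then be adjacent to \<open>f\<close>; this end and \<open>f\<close> were
  both unmatched before and formed a path of length one avoiding \<open>x\<close>, which was
  excluded. The last two claims are what the hidden nodes and the counters need.\<close>

lemma augment1:
  assumes wf: "wf_nb n nb" and mo: "mates_ok n nb mt" and ns: "no_short nb mt {x}"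
    and x: "mt x = 0" and f: "f \<in> nb x" "mt f = 0"
  defines "mt' \<equiv> mt(x := f, f := x)"
  shows "mates_ok n nb mt'" "no_short nb mt' {}"
    and "0 < w \<Longrightarrow> mt' w = w \<longleftrightarrow> mt w = w"
    and "{y. mt' y = 0} = {y. mt y = 0} - {x} - {f}"
proof -
  note fx = wf_nbD[OF wf f(1)]
  have mt': "mt' x = f" "mt' f = x" "\<And>a. a \<noteq> x \<Longrightarrow> a \<noteq> f \<Longrightarrow> mt' a = mt a"
    using fx by (simp_all add: mt'_def)
  show "mates_ok n nb mt'"
    unfolding mates_ok_def
  proof (intro allI impI)
    fix y assume y: "0 < y \<and> y \<le> n \<and> mt' y \<noteq> 0 \<and> mt' y \<noteq> y"
    show "mt' y \<in> nb y \<and> mt' (mt' y) = y"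
    proof (cases "y = x \<or> y = f")
      case True
      then show ?thesis using fx f by (auto simp: mt'_def)
    next
      case False
      then have "mt y \<in> nb y \<and> mt (mt y) = y" using y mates_okD[OF mo] by (auto simp: mt'_def)
      moreover have "mt y \<noteq> x" "mt y \<noteq> f" using calculation x f y by auto
      ultimately show ?thesis using False by (simp add: mt'_def)
    qed
  qed
  have free: "mt a = 0 \<and> a \<noteq> x \<and> a \<noteq> f" if "mt' a = 0" for a
    using that fx by (auto simp: mt'_def split: if_splits)
  show "no_short nb mt' {}"
    unfolding no_short_def
  proof (intro conjI allI impI)
    fix a d assume "d \<in> nb a \<and> mt' a = 0 \<and> mt' d = 0"
    then show "a \<in> {} \<or> d \<in> {}" using no_short1[OF ns, of d a] free by auto
  next
    fix a b d
    assume p: "b \<in> nb a \<and> mt' a = 0 \<and> mt' b \<noteq> 0 \<and> mt' b \<noteq> b \<and> d \<in> nb (mt' b) \<and> mt' d = 0 \<and> a \<noteq> d"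
    then have fr: "mt a = 0" "mt d = 0" "a \<noteq> x" "a \<noteq> f" "d \<noteq> x" "d \<noteq> f"
      using free[of a] free[of d] by simp_all
    have "False" if "b = x"
    proof -
      have "d \<in> nb f" using p that mt'(1) by simp
      from no_short1[OF ns this f(2) fr(2)] show False using fr fx by simp
    qed
    moreover have "False" if "b = f"
    proof -
      have "f \<in> nb a" using p that by simp
      from no_short1[OF ns this fr(1) f(2)] show False using fr fx by simp
    qed
    moreover have "False" if "b \<noteq> x" "b \<noteq> f"
    proof -
      have "mt' b = mt b" using that mt'(3) by simp
      then show False using no_short3[OF ns, of b a d] p fr by simp
    qed
    ultimately show "a \<in> {} \<or> d \<in> {}" by blast
  qed
  show "0 < w \<Longrightarrow> mt' w = w \<longleftrightarrow> mt w = w" using fx x f by (auto simp: mt'_def)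
  show "{y. mt' y = 0} = {y. mt y = 0} - {x} - {f}" using fx by (auto simp: mt'_def)
qed

text \<open>There are two new candidates for the middle of a short path. If it is the edge between
  \<open>x\<close> and \<open>g\<close>, an end of the path is an unmatched neighbour of
  \<open>x\<close>, and there is none: here the preference for length one enters. If it is the edge
  between \<open>y\<close> and \<open>z\<close>, an end together with \<open>z\<close> was already a
  path of length one avoiding \<open>x\<close>. The assumption \<open>y \<noteq> g\<close> says that
  \<open>g\<close> is not hidden.\<close>

lemma augment3:
  assumes wf: "wf_nb n nb" and mo: "mates_ok n nb mt" and ns: "no_short nb mt {x}"
    and x: "mt x = 0" "\<And>f. f \<in> nb x \<Longrightarrow> mt f \<noteq> 0"
    and g: "g \<in> nb x" "mt g = y" "y \<noteq> g" and z: "z \<in> nb y" "mt z = 0" "z \<noteq> x"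
  defines "mt' \<equiv> mt(x := g, g := x, y := z, z := y)"
  shows "mates_ok n nb mt'" "no_short nb mt' {}"
    and "0 < w \<Longrightarrow> mt' w = w \<longleftrightarrow> mt w = w"
    and "{y. mt' y = 0} = {y. mt y = 0} - {x} - {z}"
proof -
  note gx = wf_nbD[OF wf g(1)] and zy = wf_nbD[OF wf z(1)]
  have y: "mt y = g" using mates_okD[OF mo, of g] gx zy g by auto
  have g0: "mt g \<noteq> 0" "mt y \<noteq> 0" using y g zy gx by auto
  have ne: "x \<noteq> g" "x \<noteq> y" "x \<noteq> z" "g \<noteq> y" "g \<noteq> z" "y \<noteq> z"
    using gx zy x(1) z(2,3) g0 g(3) by auto
  have mt': "mt' x = g" "mt' g = x" "mt' y = z" "mt' z = y"
    "\<And>a. a \<noteq> x \<Longrightarrow> a \<noteq> g \<Longrightarrow> a \<noteq> y \<Longrightarrow> a \<noteq> z \<Longrightarrow> mt' a = mt a"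
    using ne by (auto simp: mt'_def)
  show "mates_ok n nb mt'"
    unfolding mates_ok_def
  proof (intro allI impI)
    fix a assume a: "0 < a \<and> a \<le> n \<and> mt' a \<noteq> 0 \<and> mt' a \<noteq> a"
    show "mt' a \<in> nb a \<and> mt' (mt' a) = a"
    proof (cases "a \<in> {x, g, y, z}")
      case True
      then show ?thesis using gx zy g z mt' by auto
    next
      case False
      then have "mt a \<in> nb a \<and> mt (mt a) = a" using a mates_okD[OF mo] mt' by auto
      moreover have "mt a \<noteq> x" "mt a \<noteq> g" "mt a \<noteq> y" "mt a \<noteq> z"
        using calculation False a x(1) g z(2) y by auto
      ultimately show ?thesis using False mt' by auto
    qed
  qed
  have free: "mt a = 0 \<and> a \<noteq> x \<and> a \<noteq> z \<and> a \<noteq> g \<and> a \<noteq> y" if "mt' a = 0" for a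
    using that mt' gx zy by (metis less_irrefl)
  show "no_short nb mt' {}"
    unfolding no_short_def
  proof (intro conjI allI impI)
    fix a d assume "d \<in> nb a \<and> mt' a = 0 \<and> mt' d = 0"
    then show "a \<in> {} \<or> d \<in> {}" using no_short1[OF ns, of d a] free by auto
  next
    fix a b d
    assume p: "b \<in> nb a \<and> mt' a = 0 \<and> mt' b \<noteq> 0 \<and> mt' b \<noteq> b \<and> d \<in> nb (mt' b) \<and> mt' d = 0 \<and> a \<noteq> d"
    then have fr: "mt a = 0" "mt d = 0" "a \<noteq> x" "a \<noteq> z" "d \<noteq> x" "d \<noteq> z"
      using free by auto
    have "False" if "b = x"
    proof -
      have "a \<in> nb x" using p that wf_nbD[OF wf, of b a] by blast
      then show False using x(2) fr(1) by blast
    qed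
    moreover have "False" if "b = g"
    proof -
      have "d \<in> nb x" using p that mt'(2) by simp
      then show False using x(2) fr(2) by blast
    qed
    moreover have "False" if "b = y"
    proof -
      have "d \<in> nb z" using p that mt'(3) by simp
      from no_short1[OF ns this z(2) fr(2)] show False using fr z(3) by simp
    qed
    moreover have "False" if "b = z"
    proof -
      have "z \<in> nb a" using p that by simp
      from no_short1[OF ns this fr(1) z(2)] show False using fr z(3) by simp
    qed
    moreover have "False" if "b \<noteq> x" "b \<noteq> g" "b \<noteq> y" "b \<noteq> z"
    proof -
      have "mt' b = mt b" using that mt'(5) by simp
      then show False using no_short3[OF ns, of b a d] p fr by simp
    qed
    ultimately show "a \<in> {} \<or> d \<in> {}" by blast
  qed
  show "mt' w = w \<longleftrightarrow> mt w = w" if "0 < w"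
  proof -
    consider "w = x" | "w = g" | "w = y" | "w = z" | "w \<noteq> x" "w \<noteq> g" "w \<noteq> y" "w \<noteq> z" by blast
    then show ?thesis
    proof cases
      case 1 then show ?thesis using that mt'(1) ne(1) x(1) by simp
    next
      case 2 then show ?thesis using mt'(2) ne(1) g(2,3) by simp
    next
      case 3 then show ?thesis using mt'(3) ne(6) y g(3) by simp
    next
      case 4 then show ?thesis using that mt'(4) ne(6) z(2) by simp
    next
      case 5 then show ?thesis using mt'(5) by simp
    qed
  qed
  have "mt' a = 0 \<longleftrightarrow> mt a = 0 \<and> a \<noteq> x \<and> a \<noteq> z" for a
  proof
    assume "mt' a = 0"
    then show "mt a = 0 \<and> a \<noteq> x \<and> a \<noteq> z" using free by blast
  next
    assume a: "mt a = 0 \<and> a \<noteq> x \<and> a \<noteq> z"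
    then have "a \<noteq> g" "a \<noteq> y" using g0 by blast+
    then show "mt' a = 0" using a mt'(5) by simp
  qed
  then show "{y. mt' y = 0} = {y. mt y = 0} - {x} - {z}" by auto
qed

text \<open>Every short path left must end in \<open>x\<close>. Its neighbour on the path is either
  unmatched or has a mate with an unmatched neighbour other than \<open>x\<close>, and a scan around
  \<open>x\<close> has ruled out both.\<close>

lemma augment_none:
  assumes wf: "wf_nb n nb" and mo: "mates_ok n nb mt" and ns: "no_short nb mt {x}"
    and f: "\<And>f. f \<in> nb x \<Longrightarrow> mt f \<noteq> 0"
    and g: "\<And>g. g \<in> nb x \<Longrightarrow> mt g \<noteq> 0 \<Longrightarrow> nb (mt g) \<inter> ({y. mt y = 0} - {x}) = {}"
  shows "no_short nb mt {}"
  unfolding no_short_def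
proof (intro conjI allI impI)
  fix a d assume "d \<in> nb a \<and> mt a = 0 \<and> mt d = 0"
  then show "a \<in> {} \<or> d \<in> {}" using no_short1[OF ns, of d a] f[of a] f[of d] wf_nbD[OF wf, of d a] by auto
next
  fix a b d
  assume p: "b \<in> nb a \<and> mt a = 0 \<and> mt b \<noteq> 0 \<and> mt b \<noteq> b \<and> d \<in> nb (mt b) \<and> mt d = 0 \<and> a \<noteq> d"
  then consider "a = x" | "d = x" using no_short3[OF ns, of b a d] by auto
  then show "a \<in> {} \<or> d \<in> {}"
  proof cases
    case 1
    then show ?thesis using p g[of b] by auto
  next
    case 2
    \<comment> \<open>The path is read backwards: from \<open>x\<close> it goes to
      \<open>mt b\<close>, whose mate is \<open>b\<close>, and then to \<open>a\<close>.\<close>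
    have b: "b \<in> nb a" "a \<in> nb b" "0 < b" "b \<le> n" using p wf_nbD[OF wf, of b a] by auto
    then have m: "mt b \<in> nb b" "mt (mt b) = b" using p mates_okD[OF mo, of b] by auto
    have "mt b \<in> nb x" using p 2 wf_nbD[OF wf, of d "mt b"] by auto
    then show ?thesis using g[of "mt b"] m(2) b p 2 by auto
  qed
qed

section \<open>The update procedure\<close>

text \<open>Frame condition of the procedures that change the matching but not the graph. Mates and
  counters are left out because each rule describes them separately.\<close>

definition keeps :: "nat set \<Rightarrow> state \<Rightarrow> state \<Rightarrow> bool" where
  "keeps K s t \<longleftrightarrow> (\<forall>j x. t (Adj j x) = s (Adj j x)) \<and> t (Lev 1) = s (Lev 1) \<and>
     (\<forall>k. k \<notin> K \<longrightarrow> t (Reg k) = s (Reg k))"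

definition mates :: "state \<Rightarrow> nat \<Rightarrow> nat" where
  "mates s x = s (Mate x)"

lemma mates_upd [simp]:
  "mates (s(Lev i := v)) = mates s" "mates (s(Reg k := v)) = mates s"
  "mates (s(Cnt x := v)) = mates s" "mates (s(Adj j x := v)) = mates s"
  "mates (s(Mate x := v)) = (mates s)(x := v)"
  by (auto simp: mates_def)

text \<open>
  A slot containing 0 is vacant. Insertions use the first vacant slot, which bounds the number of rows
  by the maximum degree, although deletions leave gaps.
\<close>

definition slots :: "nat \<Rightarrow> nat \<Rightarrow> (nat \<Rightarrow> nat set) \<Rightarrow> state \<Rightarrow> bool" where
  "slots n h nb s \<longleftrightarrow> s (Lev 1) \<le> h \<and>
     (\<forall>x y. 0 < x \<and> x \<le> n \<longrightarrow> y \<in> nb x \<longleftrightarrow> 0 < y \<and> (\<exists>j. s (Adj j x) = y)) \<and>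
     (\<forall>x i j. 0 < x \<and> x \<le> n \<and> s (Adj i x) = s (Adj j x) \<and> s (Adj i x) \<noteq> 0 \<longrightarrow> i = j) \<and>
     (\<forall>x j. 0 < x \<and> x \<le> n \<and> s (Lev 1) \<le> j \<longrightarrow> s (Adj j x) = 0)"

text \<open>The set of counted nodes is a parameter, since in the middle of an augmentation the
  counters run ahead of the mates or lag behind them.\<close>

definition counts :: "nat \<Rightarrow> (nat \<Rightarrow> nat set) \<Rightarrow> nat set \<Rightarrow> state \<Rightarrow> bool" where
  "counts n nb F s \<longleftrightarrow> (\<forall>x. 0 < x \<and> x \<le> n \<longrightarrow> s (Cnt x) = card (nb x \<inter> F))"

lemma slotsD:
  assumes "slots n h nb s"
  shows "s (Lev 1) \<le> h"
    and "0 < x \<Longrightarrow> x \<le> n \<Longrightarrow> y \<in> nb x \<longleftrightarrow> 0 < y \<and> (\<exists>j. s (Adj j x) = y)"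
    and "0 < x \<Longrightarrow> x \<le> n \<Longrightarrow> s (Adj i x) = s (Adj j x) \<Longrightarrow> s (Adj i x) \<noteq> 0 \<Longrightarrow> i = j"
    and "0 < x \<Longrightarrow> x \<le> n \<Longrightarrow> s (Lev 1) \<le> j \<Longrightarrow> s (Adj j x) = 0"
  using assms unfolding slots_def by blast+

lemma slots_keeps: "slots n h nb s \<Longrightarrow> keeps K s t \<Longrightarrow> slots n h nb t"
proof -
  assume sl: "slots n h nb s" and k: "keeps K s t"
  have eq: "t (Lev 1) = s (Lev 1)" "\<And>j x. t (Adj j x) = s (Adj j x)"
    using k by (simp_all only: keeps_def)
  show "slots n h nb t" unfolding slots_def eq by (rule sl[unfolded slots_def])
qed

lemma keeps_trans: "keeps K s t \<Longrightarrow> keeps L t u \<Longrightarrow> keeps (K \<union> L) s u"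
  by (simp add: keeps_def)

lemma keeps_mono: "keeps K s t \<Longrightarrow> K \<subseteq> L \<Longrightarrow> keeps L s t"
  unfolding keeps_def by blast

lemma keeps_upd:
  "keeps K s (t(Mate x := v)) \<longleftrightarrow> keeps K s t"
  "keeps K s (t(Cnt x := v)) \<longleftrightarrow> keeps K s t"
  "keeps K s (t(Lev 0 := v)) \<longleftrightarrow> keeps K s t"
  "k \<in> K \<Longrightarrow> keeps K s (t(Reg k := v)) \<longleftrightarrow> keeps K s t"
  unfolding keeps_def by auto

lemma keeps_refl [simp]: "keeps K s s"
  by (simp add: keeps_def)

section \<open>Correcting the counters of all neighbours of a node\<close>

lemma ex_ge_Suc: "(\<exists>i\<ge>j. P i) \<longleftrightarrow> P j \<or> (\<exists>i\<ge>Suc j. P i)" for j :: nat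
  using le_eq_less_or_eq Suc_le_eq by metis

lemma all_ge_Suc: "(\<forall>i\<ge>j. P i) \<longleftrightarrow> P j \<and> (\<forall>i\<ge>Suc j. P i)" for j :: nat
  using le_eq_less_or_eq Suc_le_eq by metis

definition bump :: "bool \<Rightarrow> nat \<Rightarrow> com" where
  "bump b k = Each (Mov (RReg 3) (RAdj k) ;;
     If (RReg 3) (if b then Plus (RCnt 3) (RCnt 3) (RReg 9) else Minus (RCnt 3) (RCnt 3) (RReg 9)) Skip)"

text \<open>Every neighbour occupies exactly one slot, so its counter is changed exactly once.
  Register 9 supplies the constant 1, there being no addition of literals.\<close>

lemma wp_bump:
  assumes sl: "slots n h nb s" and wf: "wf_nb n nb"
    and k: "k < 11" "k \<noteq> 3" and x: "s (Reg k) = x" "0 < x" "x \<le> n" and one: "s (Reg 9) = 1"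
    and cont: "\<And>t. keeps {3} s t \<Longrightarrow> mates t = mates s \<Longrightarrow>
      (\<And>w. t (Cnt w) = (if w \<in> nb x then if b then s (Cnt w) + 1 else s (Cnt w) - 1 else s (Cnt w))) \<Longrightarrow> Q t"
  shows "wp n h (bump b k) Q s"
proof -
  define f where "f v = (if b then s (Cnt v) + 1 else s (Cnt v) - 1)" for v
  \<comment> \<open>The counters once the rows from \<open>j\<close> on have been visited.\<close>
  define g where "g j v = (if v \<noteq> 0 \<and> (\<exists>i\<ge>j. s (Adj i x) = v) then f v else s (Cnt v))" for j v
  have g_top: "g (s (Lev 1)) v = s (Cnt v)" for v
  proof -
    have "\<not> (v \<noteq> 0 \<and> (\<exists>i\<ge>s (Lev 1). s (Adj i x) = v))"
    proof
      assume "v \<noteq> 0 \<and> (\<exists>i\<ge>s (Lev 1). s (Adj i x) = v)"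
      then obtain i where "s (Lev 1) \<le> i" "s (Adj i x) = v" "v \<noteq> 0" by blast
      then show False using slotsD(4)[OF sl x(2,3), of i] by simp
    qed
    then show ?thesis unfolding g_def by (rule if_not_P)
  qed
  have g_0: "g 0 v = (if v \<in> nb x then f v else s (Cnt v))" for v
    unfolding g_def slotsD(2)[OF sl x(2,3)] by simp
  have g_same: "g j v = g (Suc j) v" if "v \<noteq> s (Adj j x) \<or> v = 0" for j v
    using that unfolding g_def ex_ge_Suc[of j] by auto
  have g_new: "g j v = f v" "g (Suc j) v = s (Cnt v)" if "v = s (Adj j x)" "v \<noteq> 0" for j v
  proof -
    show "g j v = f v" unfolding g_def ex_ge_Suc[of j] using that by simp
    have "\<not> (\<exists>i\<ge>Suc j. s (Adj i x) = v)"
      using slotsD(3)[OF sl x(2,3), of _ j] that by (metis Suc_n_not_le_n)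
    then show "g (Suc j) v = s (Cnt v)" unfolding g_def by (simp only: simp_thms if_False)
  qed
  show ?thesis
    unfolding bump_def
  proof (rule wp_Each[where I = "\<lambda>j t. keeps {3} s t \<and> mates t = mates s \<and> (\<forall>w. t (Cnt w) = g j w)"])
    show "s (Lev 1) \<le> h" using slotsD(1)[OF sl] .
    show "keeps {3} s (s(Lev 0 := s (Lev 1))) \<and> mates (s(Lev 0 := s (Lev 1))) = mates s \<and>
        (\<forall>w. (s(Lev 0 := s (Lev 1))) (Cnt w) = g (s (Lev 1)) w)"
      by (simp only: g_top keeps_upd keeps_refl mates_upd) simp
  next
    fix t assume "keeps {3} s t \<and> mates t = mates s \<and> (\<forall>w. t (Cnt w) = g 0 w)"
    then show "Q t" by (intro cont) (simp_all only: g_0 f_def)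
  next
    fix j t
    assume "keeps {3} s t \<and> mates t = mates s \<and> (\<forall>w. t (Cnt w) = g (Suc j) w)"
    then have I: "keeps {3} s t" "mates t = mates s" "\<And>w. t (Cnt w) = g (Suc j) w" by blast+
    define w where "w = s (Adj j x)"
    have t: "t (Reg k) = x" "t (Adj j x) = w" "t (Reg 9) = 1"
      using I(1) k x one by (simp_all add: keeps_def w_def)
    have w: "w \<noteq> 0 \<Longrightarrow> w \<le> n"
      using slotsD(2)[OF sl x(2,3), of w] wf_nbD[OF wf, of w x] unfolding w_def by blast
    note same = g_same[of _ j, folded w_def] and new = g_new[of w j, folded w_def]
    show "wp n h (Mov (RReg 3) (RAdj k) ;;
       If (RReg 3) (if b then Plus (RCnt 3) (RCnt 3) (RReg 9) else Minus (RCnt 3) (RCnt 3) (RReg 9)) Skip)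
       (\<lambda>t'. t' (Lev 0) = j \<and> keeps {3} s t' \<and> mates t' = mates s \<and> (\<forall>w. t' (Cnt w) = g j w))
       (t(Lev 0 := j))"
    proof (cases "w = 0")
      case True
      then have "g (Suc j) v = g j v" for v using same[of v] by (cases "v = 0") simp_all
      then show ?thesis using t k x I True by (simp add: keeps_upd)
    next
      case False
      then have "g j v = (if v = w then f w else g (Suc j) v)" for v using same[of v] new(1) by simp
      then show ?thesis using t k x I w False new(2) by (cases b) (simp_all add: keeps_upd f_def)
    qed
  qed
qed

lemma card_Int_remove: "finite A \<Longrightarrow> x \<in> F \<Longrightarrow>
    card (A \<inter> (F - {x})) = (if x \<in> A then card (A \<inter> F) - 1 else card (A \<inter> F))"
  by (simp add: card_Diff_singleton_if flip: Int_Diff)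

lemma card_Int_insert: "finite A \<Longrightarrow> x \<notin> F \<Longrightarrow>
    card (A \<inter> insert x F) = (if x \<in> A then card (A \<inter> F) + 1 else card (A \<inter> F))"
  by simp

text \<open>Adjacency is symmetric, so the nodes whose count changes when \<open>x\<close> enters or
  leaves \<open>F\<close> are precisely the neighbours of \<open>x\<close>.\<close>

lemma wp_bump_counts:
  assumes sl: "slots n h nb s" and wf: "wf_nb n nb" and c: "counts n nb F s"
    and k: "k < 11" "k \<noteq> 3" and x: "s (Reg k) = x" "0 < x" "x \<le> n" and one: "s (Reg 9) = 1"
    and b: "b \<longleftrightarrow> x \<notin> F"
    and cont: "\<And>t. keeps {3} s t \<Longrightarrow> mates t = mates s \<Longrightarrow>
      counts n nb (if b then insert x F else F - {x}) t \<Longrightarrow> Q t"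
  shows "wp n h (bump b k) Q s"
proof (rule wp_bump[OF sl wf k x one])
  fix t assume t: "keeps {3} s t" "mates t = mates s"
    "\<And>w. t (Cnt w) = (if w \<in> nb x then if b then s (Cnt w) + 1 else s (Cnt w) - 1 else s (Cnt w))"
  have sym: "w \<in> nb x \<longleftrightarrow> x \<in> nb w" for w using wf_nbD[OF wf] by blast
  have "counts n nb (if b then insert x F else F - {x}) t"
    unfolding counts_def
  proof (intro allI impI)
    fix w assume w: "0 < w \<and> w \<le> n"
    then have "s (Cnt w) = card (nb w \<inter> F)" using c by (simp add: counts_def)
    then show "t (Cnt w) = card (nb w \<inter> (if b then insert x F else F - {x}))"
      using b t(3)[of w] card_Int_remove[OF wf_nb_finite[OF wf, of w], of x F]
        card_Int_insert[OF wf_nb_finite[OF wf, of w], of x F] by (simp only: sym) (auto simp: sym)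
  qed
  with t(1,2) show "Q t" by (rule cont)
qed

section \<open>Scans of a neighbourhood\<close>

definition found :: "(nat \<Rightarrow> nat set) \<Rightarrow> state \<Rightarrow> nat \<Rightarrow> (nat \<Rightarrow> bool) \<Rightarrow> nat \<Rightarrow> nat \<Rightarrow> bool" where
  "found nb s x p j f \<longleftrightarrow>
     (if f = 0 then \<forall>i\<ge>j. s (Adj i x) = 0 \<or> \<not> p (s (Adj i x)) else f \<in> nb x \<and> p f)"

lemma found_top: "slots n h nb s \<Longrightarrow> 0 < x \<Longrightarrow> x \<le> n \<Longrightarrow> found nb s x p (s (Lev 1)) 0"
  using slotsD(4) by (simp add: found_def)

text \<open>Once all rows have been visited the result is decisive in both directions: 0 excludes
  every neighbour, as 0 is not a node, and a nonzero result is itself a witness.\<close>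

lemma found_0:
  assumes "slots n h nb s" "0 < x" "x \<le> n" "found nb s x p 0 f"
  shows "f = 0 \<Longrightarrow> w \<in> nb x \<Longrightarrow> \<not> p w" and "f \<noteq> 0 \<Longrightarrow> f \<in> nb x \<and> p f"
proof -
  assume f: "f = 0" and "w \<in> nb x"
  then obtain j where j: "s (Adj j x) = w" "0 < w" using slotsD(2)[OF assms(1-3), of w] by blast
  have "\<forall>i. s (Adj i x) = 0 \<or> \<not> p (s (Adj i x))" using assms(4) unfolding found_def f by simp
  then have "s (Adj j x) = 0 \<or> \<not> p (s (Adj j x))" by blast
  then show "\<not> p w" using j by simp
next
  show "f \<noteq> 0 \<Longrightarrow> f \<in> nb x \<and> p f" using assms(4) by (simp add: found_def)
qed

lemma found_keep: "found nb s x p (Suc j) f \<Longrightarrow> s (Adj j x) = 0 \<or> \<not> p (s (Adj j x)) \<Longrightarrow> found nb s x p j f"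
  unfolding found_def by (simp only: all_ge_Suc[of j "\<lambda>i. s (Adj i x) = 0 \<or> \<not> p (s (Adj i x))"]) simp

lemma found_new:
  assumes "slots n h nb s" "0 < x" "x \<le> n" "s (Adj j x) \<noteq> 0" "p (s (Adj j x))"
  shows "found nb s x p j (s (Adj j x))"
proof -
  have "s (Adj j x) \<in> nb x" using slotsD(2)[OF assms(1-3), of "s (Adj j x)"] assms(4) by blast
  then show ?thesis using assms(4,5) by (simp add: found_def)
qed

lemma slot_nb:
  assumes "slots n h nb s" "wf_nb n nb" "0 < x" "x \<le> n" "s (Adj j x) \<noteq> 0"
  shows "s (Adj j x) \<in> nb x" "s (Adj j x) \<le> n"
proof -
  show "s (Adj j x) \<in> nb x" using slotsD(2)[OF assms(1,3,4), of "s (Adj j x)"] assms(5) by blast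
  then show "s (Adj j x) \<le> n" using wf_nbD[OF assms(2)] by blast
qed

text \<open>One pass collects both kinds of candidates: register 5 receives an unmatched neighbour,
  register 6 a matched one whose mate has a positive counter. The preference between them is left to
  the caller.\<close>

definition search :: "nat \<Rightarrow> com" where
  "search k = Const 5 0 ;; Const 6 0 ;; Each (Mov (RReg 3) (RAdj k) ;; If (RReg 3)
     (Mov (RReg 4) (RMate 3) ;;
      If (RReg 4) (If (RCnt 4) (Mov (RReg 6) (RReg 3)) Skip) (Mov (RReg 5) (RReg 3))) Skip)"

lemma wp_search:
  assumes sl: "slots n h nb s" and wf: "wf_nb n nb"
    and k: "k < 11" "k \<notin> {3, 4, 5, 6}" and x: "s (Reg k) = x" "0 < x" "x \<le> n"
    and range: "\<And>w. w \<in> nb x \<Longrightarrow> mates s w \<le> n"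
    and cont: "\<And>t. keeps {3, 4, 5, 6} s t \<Longrightarrow> mates t = mates s \<Longrightarrow> (\<And>w. t (Cnt w) = s (Cnt w)) \<Longrightarrow>
      found nb s x (\<lambda>w. mates s w = 0) 0 (t (Reg 5)) \<Longrightarrow>
      found nb s x (\<lambda>w. mates s w \<noteq> 0 \<and> s (Cnt (mates s w)) \<noteq> 0) 0 (t (Reg 6)) \<Longrightarrow> Q t"
  shows "wp n h (search k) Q s"
proof -
  define p where "p = (\<lambda>w. mates s w = 0)"
  define q where "q = (\<lambda>w. mates s w \<noteq> 0 \<and> s (Cnt (mates s w)) \<noteq> 0)"
  define I where "I = (\<lambda>j t. keeps {3, 4, 5, 6} s t \<and> mates t = mates s \<and> (\<forall>w. t (Cnt w) = s (Cnt w)) \<and>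
    found nb s x p j (t (Reg 5)) \<and> found nb s x q j (t (Reg 6)))"
  define s0 where "s0 = s(Reg 5 := 0, Reg 6 := 0)"
  have s0: "s0 (Lev 1) = s (Lev 1)" by (simp add: s0_def)
  have "wp n h (Each (Mov (RReg 3) (RAdj k) ;; If (RReg 3) (Mov (RReg 4) (RMate 3) ;;
      If (RReg 4) (If (RCnt 4) (Mov (RReg 6) (RReg 3)) Skip) (Mov (RReg 5) (RReg 3))) Skip)) Q s0"
  proof (rule wp_Each[where I = I])
    show "s0 (Lev 1) \<le> h" unfolding s0 using slotsD(1)[OF sl] .
    show "I (s0 (Lev 1)) (s0(Lev 0 := s0 (Lev 1)))"
      unfolding I_def s0 using found_top[OF sl x(2,3)] by (simp add: s0_def keeps_upd)
  next
    fix t assume "I 0 t"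
    then show "Q t" unfolding I_def p_def q_def by (intro cont) blast+
  next
    fix j t
    assume "I (Suc j) t"
    then have I: "keeps {3, 4, 5, 6} s t" "mates t = mates s" "\<And>w. t (Cnt w) = s (Cnt w)"
      "found nb s x p (Suc j) (t (Reg 5))" "found nb s x q (Suc j) (t (Reg 6))"
      unfolding I_def by blast+
    define w where "w = s (Adj j x)"
    have t: "t (Reg k) = x" "t (Adj j x) = w" using I(1) k x by (simp_all add: keeps_def w_def)
    have tm: "t (Mate v) = mates s v" for v using I(2) by (metis mates_def)
    have w: "w \<in> nb x" "w \<le> n" if "w \<noteq> 0"
      using slot_nb[OF sl wf x(2,3), of j] that unfolding w_def by blast+
    note keep = found_keep[of nb s x _ j, folded w_def] and new = found_new[OF sl x(2,3), of j, folded w_def]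
    show "wp n h (Mov (RReg 3) (RAdj k) ;; If (RReg 3) (Mov (RReg 4) (RMate 3) ;;
        If (RReg 4) (If (RCnt 4) (Mov (RReg 6) (RReg 3)) Skip) (Mov (RReg 5) (RReg 3))) Skip)
        (\<lambda>t'. t' (Lev 0) = j \<and> I j t') (t(Lev 0 := j))"
    proof (cases "w = 0")
      case True
      then have "I j (t(Lev 0 := j, Reg 3 := w))"
        unfolding I_def using I keep by (simp add: keeps_upd)
      then show ?thesis using t k x True by simp
    next
      case False
      note w = w[OF False]
      have mw: "mates s w \<le> n" using range w(1) .
      define t1 where "t1 = t(Lev 0 := j, Reg 3 := w, Reg 4 := mates s w)"
      have t1: "keeps {3, 4, 5, 6} s t1" "mates t1 = mates s" "\<And>w. t1 (Cnt w) = s (Cnt w)"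
        "t1 (Reg 5) = t (Reg 5)" "t1 (Reg 6) = t (Reg 6)" "t1 (Lev 0) = j"
        using I by (simp_all add: t1_def keeps_upd)
      consider (p) "mates s w = 0" | (q) "mates s w \<noteq> 0" "s (Cnt (mates s w)) \<noteq> 0"
        | (none) "mates s w \<noteq> 0" "s (Cnt (mates s w)) = 0" by blast
      then show ?thesis
      proof cases
        case p
        then have "p w" "\<not> q w" by (simp_all add: p_def q_def)
        then have "I j (t1(Reg 5 := w))"
          unfolding I_def using t1 new[of p] keep[of q] False I(5) by (simp add: keeps_upd)
        then show ?thesis using t k x False w tm p by (simp add: t1_def)
      next
        case q
        then have "\<not> p w" "q w" by (simp_all add: p_def q_def)
        then have "I j (t1(Reg 6 := w))"
          unfolding I_def using t1 new[of q] keep[of p] False I(4) by (simp add: keeps_upd)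
        then show ?thesis using t k x False w tm q I(3) mw by (simp add: t1_def)
      next
        case none
        then have "\<not> p w" "\<not> q w" by (simp_all add: p_def q_def)
        then have "I j t1"
          unfolding I_def using t1 keep[of q] keep[of p] False I(4,5) by simp
        then show ?thesis using t k x False w tm none I(3) mw by (simp add: t1_def)
      qed
    qed
  qed
  then show ?thesis by (simp add: search_def s0_def)
qed

definition find_free :: com where
  "find_free = Const 7 0 ;; Each (Mov (RReg 3) (RAdj 4) ;;
     If (RReg 3) (If (RMate 3) Skip (Mov (RReg 7) (RReg 3))) Skip)"

lemma wp_find_free:
  assumes sl: "slots n h nb s" and wf: "wf_nb n nb"
    and x: "s (Reg 4) = x" "0 < x" "x \<le> n"
    and cont: "\<And>t. keeps {3, 7} s t \<Longrightarrow> mates t = mates s \<Longrightarrow> (\<And>w. t (Cnt w) = s (Cnt w)) \<Longrightarrow>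
      found nb s x (\<lambda>w. mates s w = 0) 0 (t (Reg 7)) \<Longrightarrow> Q t"
  shows "wp n h find_free Q s"
proof -
  define p where "p = (\<lambda>w. mates s w = 0)"
  define I where "I = (\<lambda>j t. keeps {3, 7} s t \<and> mates t = mates s \<and> (\<forall>w. t (Cnt w) = s (Cnt w)) \<and>
    found nb s x p j (t (Reg 7)))"
  define s0 where "s0 = s(Reg 7 := 0)"
  have s0: "s0 (Lev 1) = s (Lev 1)" by (simp add: s0_def)
  have "wp n h (Each (Mov (RReg 3) (RAdj 4) ;;
     If (RReg 3) (If (RMate 3) Skip (Mov (RReg 7) (RReg 3))) Skip)) Q s0"
  proof (rule wp_Each[where I = I])
    show "s0 (Lev 1) \<le> h" unfolding s0 using slotsD(1)[OF sl] .
    show "I (s0 (Lev 1)) (s0(Lev 0 := s0 (Lev 1)))"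
      unfolding I_def s0 using found_top[OF sl x(2,3)] by (simp add: s0_def keeps_upd)
  next
    fix t assume "I 0 t"
    then show "Q t" unfolding I_def p_def by (intro cont) blast+
  next
    fix j t
    assume "I (Suc j) t"
    then have I: "keeps {3, 7} s t" "mates t = mates s" "\<And>w. t (Cnt w) = s (Cnt w)"
      "found nb s x p (Suc j) (t (Reg 7))"
      unfolding I_def by blast+
    define w where "w = s (Adj j x)"
    have t: "t (Reg 4) = x" "t (Adj j x) = w" using I(1) x by (simp_all add: keeps_def w_def)
    have tm: "t (Mate v) = mates s v" for v using I(2) by (metis mates_def)
    have w: "w \<in> nb x" "w \<le> n" if "w \<noteq> 0"
      using slot_nb[OF sl wf x(2,3), of j] that unfolding w_def by blast+
    note keep = found_keep[of nb s x _ j, folded w_def] and new = found_new[OF sl x(2,3), of j, folded w_def]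
    define t1 where "t1 = t(Lev 0 := j, Reg 3 := w)"
    have t1: "keeps {3, 7} s t1" "mates t1 = mates s" "\<And>w. t1 (Cnt w) = s (Cnt w)"
      "t1 (Reg 7) = t (Reg 7)" "t1 (Lev 0) = j"
      using I by (simp_all add: t1_def keeps_upd)
    show "wp n h (Mov (RReg 3) (RAdj 4) ;;
        If (RReg 3) (If (RMate 3) Skip (Mov (RReg 7) (RReg 3))) Skip)
        (\<lambda>t'. t' (Lev 0) = j \<and> I j t') (t(Lev 0 := j))"
    proof (cases "w \<noteq> 0 \<and> p w")
      case True
      then have "I j (t1(Reg 7 := w))"
        unfolding I_def using t1 new[of p] by (simp add: keeps_upd)
      then show ?thesis using t x True w tm by (simp add: t1_def p_def)
    next
      case False
      then have "I j t1" unfolding I_def using t1 keep[of p] I(4) by simp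
      then show ?thesis using t x False w tm by (cases "w = 0") (simp_all add: t1_def p_def)
    qed
  qed
  then show ?thesis by (simp add: find_free_def s0_def)
qed

section \<open>One attempt to augment from a given node\<close>

definition consistent :: "nat \<Rightarrow> nat \<Rightarrow> (nat \<Rightarrow> nat set) \<Rightarrow> state \<Rightarrow> bool" where
  "consistent n h nb s \<longleftrightarrow> wf_nb n nb \<and> slots n h nb s \<and> counts n nb {y. mates s y = 0} s \<and>
     mates_ok n nb (mates s) \<and> s (Reg 9) = 1"

lemma counts_cong: "counts n nb F s \<Longrightarrow> (\<And>w. t (Cnt w) = s (Cnt w)) \<Longrightarrow> counts n nb F t"
  by (simp only: counts_def)

text \<open>Taking \<open>x\<close> out of the counters is also the right correction for both
  augmentations, which leave \<open>x\<close> matched; only the failing branch must undo it. The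
  inner nodes of a path stay matched, so apart from \<open>x\<close> only the far end needs a
  correction. For length three, \<open>x\<close> is joined to its neighbour before the far end is
  sought, so that the scan cannot return \<open>x\<close>.\<close>

definition try_match :: "nat \<Rightarrow> com" where
  "try_match k = If (RMate k) Skip (bump False k ;; search k ;;
     If (RReg 5) (Mov (RMate k) (RReg 5) ;; Mov (RMate 5) (RReg k) ;; bump False 5)
     (If (RReg 6)
       (Mov (RReg 4) (RMate 6) ;; Mov (RMate k) (RReg 6) ;; Mov (RMate 6) (RReg k) ;; find_free ;;
        Mov (RMate 4) (RReg 7) ;; Mov (RMate 7) (RReg 4) ;; bump False 7)
       (bump True k)))"

text \<open>The assumption \<open>alive\<close> prevents a hidden neighbour, which is its own mate,
  from being taken for the near end of a matched edge. The last fact passed to \<open>Q\<close> says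
  that the attempt neither hides nor reveals a node.\<close>

lemma wp_try_match:
  assumes iv: "consistent n h nb s" and k: "k < 11" "k \<notin> {3, 4, 5, 6, 7}"
    and x: "s (Reg k) = x" "0 < x" "x \<le> n"
    and ns: "no_short nb (mates s) {x}" and alive: "\<And>w. w \<in> nb x \<Longrightarrow> mates s w \<noteq> w"
    and cont: "\<And>t. consistent n h nb t \<Longrightarrow> no_short nb (mates t) {} \<Longrightarrow> keeps {3, 4, 5, 6, 7} s t \<Longrightarrow>
      (\<And>w. 0 < w \<Longrightarrow> mates t w = w \<longleftrightarrow> mates s w = w) \<Longrightarrow> Q t"
  shows "wp n h (try_match k) Q s"
proof (cases "mates s x = 0")
  case False
  \<comment> \<open>The tolerated paths would end in \<open>x\<close>, which is matched.\<close>
  have "no_short nb (mates s) {}"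
    using ns False unfolding no_short_def by (metis empty_iff singletonD)
  then have "Q s" using iv by (intro cont) simp_all
  then show ?thesis using False k x by (simp add: try_match_def mates_def)
next
  case True
  define F where "F = {y. mates s y = 0}"
  have wf: "wf_nb n nb" and sl: "slots n h nb s" and ct: "counts n nb F s"
    and mo: "mates_ok n nb (mates s)" and one: "s (Reg 9) = 1"
    using iv unfolding consistent_def F_def by blast+
  have xF: "x \<in> F" using True by (simp add: F_def)
  have range: "mates s w \<le> n" if "w \<in> nb x" for w
    using mates_range[OF wf mo] wf_nbD[OF wf that] by blast
  let ?aug1 = "Mov (RMate k) (RReg 5) ;; Mov (RMate 5) (RReg k) ;; bump False 5"
  let ?aug3 = "Mov (RReg 4) (RMate 6) ;; Mov (RMate k) (RReg 6) ;; Mov (RMate 6) (RReg k) ;; find_free ;;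
        Mov (RMate 4) (RReg 7) ;; Mov (RMate 7) (RReg 4) ;; bump False 7"
  let ?rest = "If (RReg 5) ?aug1 (If (RReg 6) ?aug3 (bump True k))"
  have "wp n h (bump False k) (wp n h (search k) (wp n h ?rest Q)) s"
  proof (rule wp_bump_counts[OF sl wf ct])
    show "k < 11" "k \<noteq> 3" "s (Reg k) = x" "0 < x" "x \<le> n" "s (Reg 9) = 1" "False \<longleftrightarrow> x \<notin> F"
      using k x one xF by simp_all
    fix s1 assume s1: "keeps {3} s s1" "mates s1 = mates s"
      "counts n nb (if False then insert x F else F - {x}) s1"
    note sl1 = slots_keeps[OF sl s1(1)]
    have ct1: "counts n nb (F - {x}) s1" using s1(3) by simp
    show "wp n h (search k) (wp n h ?rest Q) s1"
    proof (rule wp_search[OF sl1 wf])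
      show "k < 11" "k \<notin> {3, 4, 5, 6}" "0 < x" "x \<le> n" using k x by simp_all
      show "s1 (Reg k) = x" using s1(1) k x by (simp add: keeps_def)
      show "mates s1 w \<le> n" if "w \<in> nb x" for w unfolding s1(2) by (rule range[OF that])
      fix t assume "keeps {3, 4, 5, 6} s1 t" and t: "mates t = mates s1" "\<And>w. t (Cnt w) = s1 (Cnt w)"
        "found nb s1 x (\<lambda>w. mates s1 w = 0) 0 (t (Reg 5))"
        "found nb s1 x (\<lambda>w. mates s1 w \<noteq> 0 \<and> s1 (Cnt (mates s1 w)) \<noteq> 0) 0 (t (Reg 6))"
      then have kt: "keeps {3, 4, 5, 6} s t" using keeps_trans[OF s1(1)] by (auto intro: keeps_mono)
      have sl2: "slots n h nb t" by (rule slots_keeps[OF sl kt])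
      have ct2: "counts n nb (F - {x}) t" using ct1 t(2) by (rule counts_cong)
      have mt: "mates t = mates s" using t(1) s1(2) by simp
      have tm: "t (Mate v) = mates s v" for v using mt by (metis mates_def)
      have treg: "t (Reg k) = x" "t (Reg 9) = 1" using kt k x one by (simp_all add: keeps_def)
      note none5 = found_0(1)[OF sl1 x(2,3) t(3), unfolded s1(2)]
        and some5 = found_0(2)[OF sl1 x(2,3) t(3), unfolded s1(2)]
        and none6 = found_0(1)[OF sl1 x(2,3) t(4), unfolded s1(2)]
        and some6 = found_0(2)[OF sl1 x(2,3) t(4), unfolded s1(2)]
      have cnt: "s1 (Cnt w) = card (nb w \<inter> (F - {x}))" if "0 < w" "w \<le> n" for w
        using ct1 that by (simp add: counts_def)
      show "wp n h ?rest Q t"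
      proof (cases "t (Reg 5) = 0")
        case False
        define f where "f = t (Reg 5)"
        have f: "f \<in> nb x" "mates s f = 0" "f \<noteq> 0" using some5 False unfolding f_def by blast+
        note fx = wf_nbD[OF wf f(1)]
        note aug = augment1[OF wf mo ns True f(1,2)]
        define t1 where "t1 = t(Mate x := f, Mate f := x)"
        have mt1: "mates t1 = (mates s)(x := f, f := x)" by (simp add: t1_def mt)
        have kt1: "keeps {3, 4, 5, 6} s t1" using kt by (simp add: t1_def keeps_upd)
        have ct3: "counts n nb (F - {x}) t1" by (rule counts_cong[OF ct2]) (simp add: t1_def)
        have "wp n h (bump False 5) Q t1"
        proof (rule wp_bump_counts[OF slots_keeps[OF sl kt1] wf ct3])
          show "t1 (Reg 5) = f" "t1 (Reg 9) = 1" by (simp_all add: t1_def f_def treg)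
          show "0 < f" "f \<le> n" using fx by simp_all
          show "False \<longleftrightarrow> f \<notin> F - {x}" using f fx by (simp add: F_def)
          fix u assume u: "keeps {3} t1 u" "mates u = mates t1"
            "counts n nb (if False then insert f (F - {x}) else F - {x} - {f}) u"
          have ku: "keeps {3, 4, 5, 6, 7} s u" using keeps_trans[OF kt1 u(1)] by (rule keeps_mono) auto
          have mu: "mates u = (mates s)(x := f, f := x)" using u(2) mt1 by simp
          show "Q u"
          proof (rule cont)
            show "keeps {3, 4, 5, 6, 7} s u" by (rule ku)
            show "no_short nb (mates u) {}" unfolding mu by (rule aug(2))
            show "0 < w \<Longrightarrow> mates u w = w \<longleftrightarrow> mates s w = w" for w unfolding mu by (rule aug(3))
            have "{w. mates u w = 0} = F - {x} - {f}" unfolding mu F_def by (rule aug(4))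
            then have "counts n nb {w. mates u w = 0} u" using u(3) by simp
            then show "consistent n h nb u"
              using wf slots_keeps[OF sl ku] aug(1) ku one unfolding consistent_def mu by (simp add: keeps_def)
          qed
        qed simp_all
        moreover have "ok n t (RMate k)" "ok n (t(Mate x := f)) (RMate 5)"
          using k x treg fx by (simp_all add: f_def)
        ultimately show ?thesis using False k by (simp add: t1_def f_def treg)
      next
        case True5: True
        note nof = none5[OF True5]
        show ?thesis
        proof (cases "t (Reg 6) = 0")
          case True
          have "no_short nb (mates s) {}"
          proof (rule augment_none[OF wf mo ns nof])
            fix g assume g: "g \<in> nb x" "mates s g \<noteq> 0"
            then have "s1 (Cnt (mates s g)) = 0" using none6[OF True g(1)] by blast
            then have "card (nb (mates s g) \<inter> (F - {x})) = 0" using cnt[of "mates s g"] g(2) range[OF g(1)] by simp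
            then show "nb (mates s g) \<inter> ({y. mates s y = 0} - {x}) = {}"
              using wf_nb_finite[OF wf] by (simp add: F_def)
          qed
          moreover have "wp n h (bump True k) Q t"
          proof (rule wp_bump_counts[OF sl2 wf ct2])
            show "k < 11" "k \<noteq> 3" "t (Reg k) = x" "0 < x" "x \<le> n" "t (Reg 9) = 1" "True \<longleftrightarrow> x \<notin> F - {x}"
              using k x treg by simp_all
            fix u assume u: "keeps {3} t u" "mates u = mates t"
              "counts n nb (if True then insert x (F - {x}) else F - {x} - {x}) u"
            have ku: "keeps {3, 4, 5, 6, 7} s u" using keeps_trans[OF kt u(1)] by (rule keeps_mono) auto
            have mu: "mates u = mates s" using u(2) mt by simp
            show "Q u"
            proof (rule cont)
              show "keeps {3, 4, 5, 6, 7} s u" by (rule ku)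
              show "no_short nb (mates u) {}" unfolding mu by fact
              show "0 < w \<Longrightarrow> mates u w = w \<longleftrightarrow> mates s w = w" for w unfolding mu by (rule refl)
              have "insert x (F - {x}) = F" using xF by blast
              then have "counts n nb {y. mates u y = 0} u" unfolding mu using u(3) by (simp add: F_def)
              then show "consistent n h nb u"
                using wf slots_keeps[OF sl ku] mo ku one unfolding consistent_def mu by (simp add: keeps_def)
            qed
          qed
          ultimately show ?thesis using True True5 by simp
        next
          case False
          define g where "g = t (Reg 6)"
          define y where "y = mates s g"
          have g: "g \<in> nb x" "y \<noteq> 0" "s1 (Cnt y) \<noteq> 0" "y \<noteq> g"
            using some6[OF False] alive[of g] unfolding g_def y_def by blast+
          note gx = wf_nbD[OF wf g(1)]
          have y: "0 < y" "y \<le> n" using g(2) range[OF g(1)] by (simp_all add: y_def)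
          have "mates s y = g" using mates_okD[OF mo, of g] gx g(2,4) unfolding y_def by blast
          then have yx: "y \<noteq> x" using True gx by auto
          define t1 where "t1 = t(Reg 4 := y, Mate x := g, Mate g := x)"
          have mt1: "mates t1 = (mates s)(x := g, g := x)" by (simp add: t1_def mt)
          have kt1: "keeps {3, 4, 5, 6} s t1" using kt by (simp add: t1_def keeps_upd)
          have ct3: "counts n nb (F - {x}) t1" by (rule counts_cong[OF ct2]) (simp add: t1_def)
          note sl3 = slots_keeps[OF sl kt1]
          let ?fin = "Mov (RMate 4) (RReg 7) ;; Mov (RMate 7) (RReg 4) ;; bump False 7"
          have "wp n h find_free (wp n h ?fin Q) t1"
          proof (rule wp_find_free[OF sl3 wf])
            show "t1 (Reg 4) = y" by (simp add: t1_def)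
            show "0 < y" "y \<le> n" by fact+
            fix u assume u: "keeps {3, 7} t1 u" "mates u = mates t1" "\<And>w. u (Cnt w) = t1 (Cnt w)"
              "found nb t1 y (\<lambda>w. mates t1 w = 0) 0 (u (Reg 7))"
            define z where "z = u (Reg 7)"
            \<comment> \<open>The counter was read while \<open>x\<close> was left out, so being
              positive it guarantees an unmatched neighbour of \<open>y\<close> other than
              \<open>x\<close>. This node is still unmatched in \<open>t1\<close>, where only
              \<open>x\<close> and \<open>g\<close> have new mates.\<close>
            have "card (nb y \<inter> (F - {x})) \<noteq> 0" using cnt[OF y] g(3) by simp
            then have "nb y \<inter> (F - {x}) \<noteq> {}" by (metis card.empty)
            then obtain w where "w \<in> nb y" "mates s w = 0" "w \<noteq> x" unfolding F_def by blast
            then have w: "w \<in> nb y" "mates t1 w = 0" using g(2) by (auto simp: mt1 y_def)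
            have "z \<noteq> 0" using found_0(1)[OF sl3 y u(4) _ w(1)] w(2) unfolding z_def by blast
            then have z: "z \<in> nb y" "mates t1 z = 0"
              using found_0(2)[OF sl3 y u(4)] unfolding z_def by blast+
            \<comment> \<open>Both are matched in \<open>t1\<close>, hence invisible to the
              scan.\<close>
            have "z \<noteq> x" "z \<noteq> g" using z(2) gx by (auto simp: mt1)
            then have mz: "mates s z = 0" "z \<noteq> x" using z(2) by (simp_all add: mt1)
            note zy = wf_nbD[OF wf z(1)]
            note aug = augment3[OF wf mo ns True nof g(1) y_def[symmetric] g(4) z(1) mz]
            define u1 where "u1 = u(Mate y := z, Mate z := y)"
            have mu1: "mates u1 = (mates s)(x := g, g := x, y := z, z := y)" by (simp add: u1_def u(2) mt1)
            have ku: "keeps {3, 4, 5, 6, 7} s u" using keeps_trans[OF kt1 u(1)] by (rule keeps_mono) auto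
            then have ku1: "keeps {3, 4, 5, 6, 7} s u1" by (simp add: u1_def keeps_upd)
            have ct4: "counts n nb (F - {x}) u1" by (rule counts_cong[OF ct3]) (simp add: u1_def u(3))
            have ureg: "u (Reg 4) = y" "u (Reg 9) = 1"
              using u(1) ku one by (simp_all add: keeps_def t1_def)
            have "wp n h (bump False 7) Q u1"
            proof (rule wp_bump_counts[OF slots_keeps[OF sl ku1] wf ct4])
              show "u1 (Reg 7) = z" "u1 (Reg 9) = 1" by (simp_all add: u1_def z_def ureg)
              show "0 < z" "z \<le> n" using zy by simp_all
              show "False \<longleftrightarrow> z \<notin> F - {x}" using mz by (simp add: F_def)
              fix v assume v: "keeps {3} u1 v" "mates v = mates u1"
                "counts n nb (if False then insert z (F - {x}) else F - {x} - {z}) v"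
              have kv: "keeps {3, 4, 5, 6, 7} s v" using keeps_trans[OF ku1 v(1)] by (rule keeps_mono) auto
              have mv: "mates v = (mates s)(x := g, g := x, y := z, z := y)" using v(2) mu1 by simp
              show "Q v"
              proof (rule cont)
                show "keeps {3, 4, 5, 6, 7} s v" by (rule kv)
                show "no_short nb (mates v) {}" unfolding mv by (rule aug(2))
                show "0 < w \<Longrightarrow> mates v w = w \<longleftrightarrow> mates s w = w" for w unfolding mv by (rule aug(3))
                have "{w. mates v w = 0} = F - {x} - {z}" unfolding mv F_def by (rule aug(4))
                then have "counts n nb {w. mates v w = 0} v" using v(3) by simp
                then show "consistent n h nb v"
                  using wf slots_keeps[OF sl kv] aug(1) kv one unfolding consistent_def mv by (simp add: keeps_def)
              qed
            qed simp_all
            moreover have "ok n u (RMate 4)" "ok n (u(Mate y := z)) (RMate 7)"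
              using y ureg zy by (simp_all add: z_def)
            ultimately show "wp n h ?fin Q u" using ureg by (simp add: u1_def z_def)
          qed
          moreover have "ok n t (RMate 6)" "ok n (t(Reg 4 := y)) (RMate k)"
            "ok n (t(Reg 4 := y, Mate x := g)) (RMate 6)"
            using k x treg gx by (simp_all add: g_def)
          ultimately show ?thesis using False True5 k treg tm[of g]
            by (simp add: t1_def g_def[symmetric] y_def[symmetric])
        qed
      qed
    qed
  qed
  then show ?thesis using True k x by (simp add: try_match_def mates_def)
qed

section \<open>Changing the neighbour lists\<close>

lemma slots_insert:
  assumes sl: "slots n h nb s" and x: "0 < x" "x \<le> n" and y: "0 < y" "y \<notin> nb x"
    and S: "S \<le> s (Lev 1)" "S < h" "s (Adj S x) = 0"
    and lev: "t (Lev 1) = s (Lev 1) + (Suc S - s (Lev 1))"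
    and adj: "\<And>j w. t (Adj j w) = (if j = S \<and> w = x then y else s (Adj j w))"
  shows "slots n h (nb(x := insert y (nb x))) t"
  unfolding slots_def
proof (intro conjI allI impI)
  \<comment> \<open>With truncated subtraction the new row count is the maximum of
    \<open>s (Lev 1)\<close> and \<open>Suc S\<close>.\<close>
  show "t (Lev 1) \<le> h" unfolding lev using slotsD(1)[OF sl] S by simp
next
  fix w v assume w: "0 < w \<and> w \<le> n"
  show "v \<in> (nb(x := insert y (nb x))) w \<longleftrightarrow> 0 < v \<and> (\<exists>j. t (Adj j w) = v)"
  proof (cases "w = x")
    case False
    then have "t (Adj j w) = s (Adj j w)" for j by (simp add: adj)
    then show ?thesis using slotsD(2)[OF sl, of w v] w False by simp
  next
    case True
    have "(\<exists>j. t (Adj j x) = v) \<longleftrightarrow> v = y \<or> (\<exists>j. j \<noteq> S \<and> s (Adj j x) = v)"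
      unfolding adj by metis
    moreover have "0 < v \<Longrightarrow> (\<exists>j. j \<noteq> S \<and> s (Adj j x) = v) \<longleftrightarrow> (\<exists>j. s (Adj j x) = v)"
      using S(3) by (metis less_irrefl)
    ultimately show ?thesis using slotsD(2)[OF sl x, of v] True y(1)
      by (metis fun_upd_same insert_iff)
  qed
next
  fix w i j assume a: "0 < w \<and> w \<le> n \<and> t (Adj i w) = t (Adj j w) \<and> t (Adj i w) \<noteq> 0"
  have new: "s (Adj i x) \<noteq> y" for i
    using slotsD(2)[OF sl x, of y] y by blast
  show "i = j"
  proof (cases "w = x \<and> (i = S \<or> j = S)")
    case True
    then show ?thesis using a new[of i] new[of j] unfolding adj by (cases "i = S"; cases "j = S") simp_all
  next
    case False
    then have "t (Adj i w) = s (Adj i w)" "t (Adj j w) = s (Adj j w)" unfolding adj by auto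
    then show ?thesis using a slotsD(3)[OF sl, of w i j] by simp
  qed
next
  fix w j assume "0 < w \<and> w \<le> n \<and> t (Lev 1) \<le> j"
  then show "t (Adj j w) = 0" using slotsD(4)[OF sl, of w j] S(1) unfolding adj lev by auto
qed

text \<open>The row count is not lowered, and the gap stays until a later insertion fills it. This
  is harmless because \<open>h\<close> bounds the degree at all times, not just the current
  one.\<close>

lemma slots_delete:
  assumes sl: "slots n h nb s" and x: "0 < x" "x \<le> n"
    and lev: "t (Lev 1) = s (Lev 1)"
    and adj: "\<And>j w. t (Adj j w) = (if w = x \<and> s (Adj j w) = y then 0 else s (Adj j w))"
  shows "slots n h (nb(x := nb x - {y})) t"
  unfolding slots_def
proof (intro conjI allI impI)
  show "t (Lev 1) \<le> h" unfolding lev by (rule slotsD(1)[OF sl])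
next
  fix w v assume w: "0 < w \<and> w \<le> n"
  show "v \<in> (nb(x := nb x - {y})) w \<longleftrightarrow> 0 < v \<and> (\<exists>j. t (Adj j w) = v)"
  proof (cases "w = x")
    case False
    then have "t (Adj j w) = s (Adj j w)" for j by (simp add: adj)
    then show ?thesis using slotsD(2)[OF sl, of w v] w False by simp
  next
    case True
    have "0 < v \<Longrightarrow> (\<exists>j. t (Adj j x) = v) \<longleftrightarrow> v \<noteq> y \<and> (\<exists>j. s (Adj j x) = v)"
      unfolding adj by (metis less_irrefl)
    then show ?thesis using slotsD(2)[OF sl x, of v] True
      by (metis Diff_iff fun_upd_same singleton_iff)
  qed
next
  fix w i j assume a: "0 < w \<and> w \<le> n \<and> t (Adj i w) = t (Adj j w) \<and> t (Adj i w) \<noteq> 0"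
  then have "t (Adj i w) = s (Adj i w)" "t (Adj j w) = s (Adj j w)" unfolding adj by (metis, metis)
  then show "i = j" using a slotsD(3)[OF sl, of w i j] by simp
next
  fix w j assume "0 < w \<and> w \<le> n \<and> t (Lev 1) \<le> j"
  then show "t (Adj j w) = 0" using slotsD(4)[OF sl, of w j] unfolding adj lev by simp
qed

text \<open>The candidate slot in \<open>Lev 2\<close> starts just past the rows in use and is
  overwritten by each vacant row met. As the loop descends, the lowest vacant row wins. It is then
  copied to \<open>Lev 0\<close>, the only level through which the table can be addressed.\<close>

definition ins_half :: "nat \<Rightarrow> nat \<Rightarrow> com" where
  "ins_half a b = Mov (RLev 2) (RLev 1) ;; Each (If (RAdj a) Skip (Mov (RLev 2) (RLev 0))) ;;
     Mov (RLev 0) (RLev 2) ;; Mov (RAdj a) (RReg b) ;;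
     IncLev 2 ;; Minus (RLev 2) (RLev 2) (RLev 1) ;; Plus (RLev 1) (RLev 1) (RLev 2) ;;
     If (RMate b) Skip (Plus (RCnt a) (RCnt a) (RReg 9))"

text \<open>Pigeonhole: the rows below the first vacant slot \<open>S\<close> hold distinct
  neighbours of \<open>x\<close>, so \<open>S\<close> is at most the old degree and therefore below
  \<open>h\<close>.\<close>

lemma wp_ins_half:
  assumes sl: "slots n h nb s" and ab: "a < 11" "b < 11"
    and x: "s (Reg a) = x" "0 < x" "x \<le> n" and y: "s (Reg b) = y" "0 < y" "y \<le> n" "y \<notin> nb x"
    and deg: "finite (nb x)" "card (nb x) < h" and one: "s (Reg 9) = 1"
    and cont: "\<And>t. slots n h (nb(x := insert y (nb x))) t \<Longrightarrow> mates t = mates s \<Longrightarrow>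
      (\<And>k. t (Reg k) = s (Reg k)) \<Longrightarrow>
      (\<And>w. t (Cnt w) = (if w = x \<and> mates s y = 0 then s (Cnt w) + 1 else s (Cnt w))) \<Longrightarrow> Q t"
  shows "wp n h (ins_half a b) Q s"
proof -
  define s0 where "s0 = s(Lev 2 := s (Lev 1))"
  define I where "I = (\<lambda>j t. \<exists>v S. t = s(Lev 0 := v, Lev 2 := S) \<and> S \<le> s (Lev 1) \<and> s (Adj S x) = 0 \<and>
     (\<forall>i. j \<le> i \<and> i < S \<longrightarrow> s (Adj i x) \<noteq> 0))"
  let ?rest = "Mov (RLev 0) (RLev 2) ;; Mov (RAdj a) (RReg b) ;;
     IncLev 2 ;; Minus (RLev 2) (RLev 2) (RLev 1) ;; Plus (RLev 1) (RLev 1) (RLev 2) ;;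
     If (RMate b) Skip (Plus (RCnt a) (RCnt a) (RReg 9))"
  have "wp n h (Each (If (RAdj a) Skip (Mov (RLev 2) (RLev 0)))) (wp n h ?rest Q) s0"
  proof (rule wp_Each[where I = I])
    show "s0 (Lev 1) \<le> h" using slotsD(1)[OF sl] by (simp add: s0_def)
    have "s0(Lev 0 := s0 (Lev 1)) = s(Lev 0 := s (Lev 1), Lev 2 := s (Lev 1))"
      by (simp add: s0_def fun_upd_twist)
    moreover have "s (Adj (s (Lev 1)) x) = 0" using slotsD(4)[OF sl x(2,3)] by simp
    ultimately show "I (s0 (Lev 1)) (s0(Lev 0 := s0 (Lev 1)))"
      unfolding I_def by (intro exI[of _ "s (Lev 1)"]) (simp add: s0_def)
  next
    fix j t assume j: "j < s0 (Lev 1)" and "I (Suc j) t"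
    then obtain v S where t: "t = s(Lev 0 := v, Lev 2 := S)" and S: "S \<le> s (Lev 1)" "s (Adj S x) = 0"
      "\<And>i. Suc j \<le> i \<Longrightarrow> i < S \<Longrightarrow> s (Adj i x) \<noteq> 0" unfolding I_def by blast
    have tj: "t(Lev 0 := j) = s(Lev 0 := j, Lev 2 := S)" unfolding t by (simp add: fun_upd_twist)
    show "wp n h (If (RAdj a) Skip (Mov (RLev 2) (RLev 0))) (\<lambda>t'. t' (Lev 0) = j \<and> I j t') (t(Lev 0 := j))"
    proof (cases "s (Adj j x) = 0")
      case True
      have "j \<le> s (Lev 1)" using j by (simp add: s0_def)
      then have "I j (s(Lev 0 := j, Lev 2 := j))"
        unfolding I_def using True by (intro exI[of _ j]) simp
      then show ?thesis using ab x True by (simp add: tj)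
    next
      case False
      have "s (Adj i x) \<noteq> 0" if "j \<le> i" "i < S" for i
        using that S(3)[of i] False by (cases "i = j") simp_all
      then have "I j (s(Lev 0 := j, Lev 2 := S))"
        unfolding I_def using S(1,2) by blast
      then show ?thesis using ab x False by (simp add: tj)
    qed
  next
    fix t assume "I 0 t"
    then obtain v S where t: "t = s(Lev 0 := v, Lev 2 := S)" and S: "S \<le> s (Lev 1)" "s (Adj S x) = 0"
      "\<And>i. i < S \<Longrightarrow> s (Adj i x) \<noteq> 0" unfolding I_def by blast
    have "inj_on (\<lambda>i. s (Adj i x)) {..<S}"
      using slotsD(3)[OF sl x(2,3)] S(3) by (intro inj_onI) blast
    moreover have "(\<lambda>i. s (Adj i x)) ` {..<S} \<subseteq> nb x"
    proof
      fix w assume "w \<in> (\<lambda>i. s (Adj i x)) ` {..<S}"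
      then obtain i where "i < S" "w = s (Adj i x)" by blast
      then show "w \<in> nb x" using slotsD(2)[OF sl x(2,3), of w] S(3)[of i] by blast
    qed
    ultimately have "S \<le> card (nb x)" using card_inj_on_le[OF _ _ deg(1)] by fastforce
    then have Sh: "S < h" using deg(2) by simp
    define t1 where "t1 = s(Lev 0 := S, Lev 2 := Suc S - s (Lev 1), Adj S x := y,
      Lev 1 := s (Lev 1) + (Suc S - s (Lev 1)))"
    define t2 where "t2 = t1(Cnt x := s (Cnt x) + 1)"
    have "slots n h (nb(x := insert y (nb x))) t1"
      by (rule slots_insert[OF sl x(2,3) y(2,4) S(1) Sh S(2)]) (simp_all add: t1_def)
    moreover have "slots n h (nb(x := insert y (nb x))) t2"
      by (rule slots_insert[OF sl x(2,3) y(2,4) S(1) Sh S(2)]) (simp_all add: t1_def t2_def)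
    ultimately have Q: "mates s y \<noteq> 0 \<Longrightarrow> Q t1" "mates s y = 0 \<Longrightarrow> Q t2"
      by (auto intro!: cont simp: t1_def t2_def)
    have e1: "t(Lev 0 := S, Adj S x := y, Lev 2 := Suc S - s (Lev 1),
      Lev 1 := s (Lev 1) + (Suc S - s (Lev 1))) = t1"
      by (rule ext) (simp add: t t1_def)
    show "wp n h ?rest Q t"
      using ab x y one Q e1 by (simp add: t t1_def t2_def mates_def)
  qed
  then show ?thesis by (simp add: ins_half_def s0_def)
qed

text \<open>There is no comparison instruction. The two truncated differences are added, and the sum
  is 0 exactly if the entries agree; subtracting the equal value then clears the slot.\<close>

definition del_half :: "nat \<Rightarrow> nat \<Rightarrow> com" where
  "del_half a b = Each (Minus (RReg 8) (RAdj a) (RReg b) ;; Minus (RReg 3) (RReg b) (RAdj a) ;;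
     Plus (RReg 8) (RReg 8) (RReg 3) ;; If (RReg 8) Skip (Minus (RAdj a) (RAdj a) (RReg b))) ;;
     If (RMate b) Skip (Minus (RCnt a) (RCnt a) (RReg 9))"

lemma wp_del_half:
  assumes sl: "slots n h nb s" and ab: "a < 11" "b < 11" "a \<notin> {3, 8}" "b \<notin> {3, 8}"
    and x: "s (Reg a) = x" "0 < x" "x \<le> n" and y: "s (Reg b) = y" "0 < y" "y \<le> n"
    and one: "s (Reg 9) = 1"
    and cont: "\<And>t. slots n h (nb(x := nb x - {y})) t \<Longrightarrow> mates t = mates s \<Longrightarrow>
      (\<And>k. k \<notin> {3, 8} \<Longrightarrow> t (Reg k) = s (Reg k)) \<Longrightarrow>
      (\<And>w. t (Cnt w) = (if w = x \<and> mates s y = 0 then s (Cnt w) - 1 else s (Cnt w))) \<Longrightarrow> Q t"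
  shows "wp n h (del_half a b) Q s"
proof -
  define I where "I = (\<lambda>j t. t (Lev 1) = s (Lev 1) \<and> mates t = mates s \<and>
     (\<forall>k. k \<notin> {3, 8} \<longrightarrow> t (Reg k) = s (Reg k)) \<and> (\<forall>w. t (Cnt w) = s (Cnt w)) \<and>
     (\<forall>i w. t (Adj i w) = (if w = x \<and> j \<le> i \<and> s (Adj i w) = y then 0 else s (Adj i w))))"
  let ?rest = "If (RMate b) Skip (Minus (RCnt a) (RCnt a) (RReg 9))"
  have "wp n h (Each (Minus (RReg 8) (RAdj a) (RReg b) ;; Minus (RReg 3) (RReg b) (RAdj a) ;;
     Plus (RReg 8) (RReg 8) (RReg 3) ;; If (RReg 8) Skip (Minus (RAdj a) (RAdj a) (RReg b))))
     (wp n h ?rest Q) s"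
  proof (rule wp_Each[where I = I])
    show "s (Lev 1) \<le> h" using slotsD(1)[OF sl] .
    have "\<not> (w = x \<and> s (Lev 1) \<le> i \<and> s (Adj i w) = y)" for i w
      using slotsD(4)[OF sl x(2,3), of i] y(2) by auto
    then have "(if w = x \<and> s (Lev 1) \<le> i \<and> s (Adj i w) = y then 0 else s (Adj i w)) = s (Adj i w)" for i w
      by (rule if_not_P)
    then show "I (s (Lev 1)) (s(Lev 0 := s (Lev 1)))"
      unfolding I_def by (simp only: mates_upd) simp
  next
    fix j t assume j: "j < s (Lev 1)" and "I (Suc j) t"
    then have I: "t (Lev 1) = s (Lev 1)" "mates t = mates s" "\<And>k. k \<notin> {3, 8} \<Longrightarrow> t (Reg k) = s (Reg k)"
      "\<And>w. t (Cnt w) = s (Cnt w)"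
      "\<And>i w. t (Adj i w) = (if w = x \<and> Suc j \<le> i \<and> s (Adj i w) = y then 0 else s (Adj i w))"
      unfolding I_def by blast+
    define w where "w = s (Adj j x)"
    have tw: "t (Adj j x) = w" using I(5)[of j x] by (simp add: w_def)
    have treg: "t (Reg a) = x" "t (Reg b) = y" using I(3) ab x y by simp_all
    \<comment> \<open>Register 8 is written twice in the body; only the second value counts.\<close>
    define t1 where "t1 = t(Lev 0 := j, Reg 3 := y - w, Reg 8 := w - y + (y - w))"
    have t1: "t1 (Lev 0) = j" "t1 (Lev 1) = s (Lev 1)" "mates t1 = mates s"
      "\<And>k. k \<notin> {3, 8} \<Longrightarrow> t1 (Reg k) = s (Reg k)" "\<And>w. t1 (Cnt w) = s (Cnt w)"
      "\<And>i v. t1 (Adj i v) = t (Adj i v)"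
      using I by (simp_all add: t1_def)
    have e1: "t(Lev 0 := j, Reg 8 := w - y, Reg 3 := y - w, Reg 8 := w - y + (y - w)) = t1"
      by (rule ext) (simp add: t1_def)
    show "wp n h (Minus (RReg 8) (RAdj a) (RReg b) ;; Minus (RReg 3) (RReg b) (RAdj a) ;;
        Plus (RReg 8) (RReg 8) (RReg 3) ;; If (RReg 8) Skip (Minus (RAdj a) (RAdj a) (RReg b)))
        (\<lambda>t'. t' (Lev 0) = j \<and> I j t') (t(Lev 0 := j))"
    proof (cases "w = y")
      case True
      have "(if v = x \<and> j \<le> i \<and> s (Adj i v) = y then 0 else s (Adj i v)) =
        (if i = j \<and> v = x then 0 else t (Adj i v))" for i v
        using True unfolding I(5) w_def by (auto simp: Suc_le_eq)
      then have "I j (t1(Adj j x := 0))"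
        unfolding I_def using t1 by simp
      then show ?thesis using ab treg x tw True e1 by (simp add: t1_def)
    next
      case False
      have "(if v = x \<and> j \<le> i \<and> s (Adj i v) = y then 0 else s (Adj i v)) = t (Adj i v)" for i v
        using False unfolding I(5) w_def by (cases "i = j") (auto simp: Suc_le_eq)
      then have "I j t1"
        unfolding I_def using t1 by simp
      have "w < y \<or> y < w" using False by linarith
      then show ?thesis
      proof
        assume "w < y"
        then show ?thesis using \<open>I j t1\<close> ab treg x tw e1 t1(1) by simp
      next
        assume "y < w"
        then show ?thesis using \<open>I j t1\<close> ab treg x tw e1 t1(1) by simp
      qed
    qed
  next
    fix t assume "I 0 t"
    then have I: "t (Lev 1) = s (Lev 1)" "mates t = mates s" "\<And>k. k \<notin> {3, 8} \<Longrightarrow> t (Reg k) = s (Reg k)"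
      "\<And>w. t (Cnt w) = s (Cnt w)"
      "\<And>i w. t (Adj i w) = (if w = x \<and> s (Adj i w) = y then 0 else s (Adj i w))"
      unfolding I_def by simp_all
    have treg: "t (Reg a) = x" "t (Reg b) = y" "t (Reg 9) = 1" using I(3) ab x y one by simp_all
    define t1 where "t1 = t(Cnt x := s (Cnt x) - 1)"
    have sl0: "slots n h (nb(x := nb x - {y})) t" by (rule slots_delete[OF sl x(2,3) I(1,5)])
    have sl1: "slots n h (nb(x := nb x - {y})) t1"
      by (rule slots_delete[OF sl x(2,3)]) (simp_all add: t1_def I(1)[unfolded One_nat_def] I(5))
    have Q: "mates s y \<noteq> 0 \<Longrightarrow> Q t" "mates s y = 0 \<Longrightarrow> Q t1"
    proof -
      show "Q t" if "mates s y \<noteq> 0" by (rule cont[OF sl0 I(2) I(3)]) (use that I(4) in simp_all)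
      have "mates t1 = mates s" "\<And>k. k \<notin> {3, 8} \<Longrightarrow> t1 (Reg k) = s (Reg k)"
        using I(2,3) by (simp_all add: t1_def)
      then show "Q t1" if "mates s y = 0" by (rule cont[OF sl1]) (use that I(4) in \<open>simp_all add: t1_def\<close>)
    qed
    have "t (Mate y) = mates s y" using I(2) by (metis mates_def)
    then show "wp n h ?rest Q t" using ab x y treg Q I(4) by (simp add: t1_def)
  qed
  then show ?thesis by (simp add: del_half_def)
qed

text \<open>\<open>Const\<close> can write registers only, so a mate is cleared by subtracting it
  from itself.\<close>

definition release :: "nat \<Rightarrow> com" where
  "release k = Minus (RMate k) (RMate k) (RMate k) ;; bump True k"

text \<open>Turning a hidden node into an unmatched one creates no matched edge and only one new
  unmatched node, so every new short path ends in \<open>x\<close>. This is the situation that an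
  attempt from \<open>x\<close> repairs.\<close>

lemma wp_rematch:
  assumes iv: "consistent n h nb s" and k: "k < 11" "k \<notin> {3, 4, 5, 6, 7}"
    and x: "s (Reg k) = x" "0 < x" "x \<le> n"
    and ns: "no_short nb (mates s) {}" and dead: "mates s x = x"
    and alive: "\<And>w. w \<in> nb x \<Longrightarrow> mates s w \<noteq> w"
    and cont: "\<And>t. consistent n h nb t \<Longrightarrow> no_short nb (mates t) {} \<Longrightarrow> keeps {3, 4, 5, 6, 7} s t \<Longrightarrow>
      (\<And>w. 0 < w \<Longrightarrow> mates t w = w \<longleftrightarrow> w \<noteq> x \<and> mates s w = w) \<Longrightarrow> Q t"
  shows "wp n h (release k) (wp n h (try_match k) Q) s"
proof -
  define F where "F = {y. mates s y = 0}"
  have wf: "wf_nb n nb" and sl: "slots n h nb s" and ct: "counts n nb F s"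
    and mo: "mates_ok n nb (mates s)" and one: "s (Reg 9) = 1"
    using iv unfolding consistent_def F_def by blast+
  define s1 where "s1 = s(Mate x := 0)"
  have k1: "keeps {} s s1" by (simp add: s1_def keeps_upd)
  have ct1: "counts n nb F s1" by (rule counts_cong[OF ct]) (simp add: s1_def)
  have "wp n h (bump True k) (wp n h (try_match k) Q) s1"
  proof (rule wp_bump_counts[OF slots_keeps[OF sl k1] wf ct1])
    show "k < 11" "k \<noteq> 3" "s1 (Reg k) = x" "0 < x" "x \<le> n" "s1 (Reg 9) = 1" "True \<longleftrightarrow> x \<notin> F"
      using k x one dead by (simp_all add: s1_def F_def)
    fix u assume u: "keeps {3} s1 u" "mates u = mates s1"
      "counts n nb (if True then insert x F else F - {x}) u"
    have ku: "keeps {3} s u" using keeps_trans[OF k1 u(1)] by simp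
    have mu: "mates u = (mates s)(x := 0)" using u(2) by (simp add: s1_def)
    show "wp n h (try_match k) Q u"
    proof (rule wp_try_match)
      show "k < 11" "k \<notin> {3, 4, 5, 6, 7}" "0 < x" "x \<le> n" by fact+
      show "u (Reg k) = x" using ku k x by (simp add: keeps_def)
      have "{w. mates u w = 0} = insert x F" unfolding mu F_def by auto
      moreover have "mates_ok n nb (mates u)"
        unfolding mates_ok_def mu
      proof (intro allI impI)
        fix z assume z: "0 < z \<and> z \<le> n \<and> ((mates s)(x := 0)) z \<noteq> 0 \<and> ((mates s)(x := 0)) z \<noteq> z"
        then have zx: "z \<noteq> x" by auto
        then have m: "mates s z \<in> nb z" "mates s (mates s z) = z"
          using mates_okD[OF mo, of z] z by auto
        \<comment> \<open>If \<open>x\<close> were the mate of \<open>z\<close>, then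
          \<open>z\<close> would be the mate of \<open>x\<close>, which is \<open>x\<close>
          itself.\<close>
        then have "mates s z \<noteq> x" using dead zx by auto
        then show "((mates s)(x := 0)) z \<in> nb z \<and> ((mates s)(x := 0)) (((mates s)(x := 0)) z) = z"
          using m zx by simp
      qed
      moreover have "u (Reg 9) = 1" using ku one by (simp add: keeps_def)
      ultimately show "consistent n h nb u"
        using wf slots_keeps[OF sl ku] u(3) unfolding consistent_def by simp
      show "no_short nb (mates u) {x}"
        unfolding no_short_def mu
      proof (intro conjI allI impI)
        fix a d assume "d \<in> nb a \<and> ((mates s)(x := 0)) a = 0 \<and> ((mates s)(x := 0)) d = 0"
        then show "a \<in> {x} \<or> d \<in> {x}"
          using no_short1[OF ns, of d a] by (auto split: if_splits)
      next
        fix a b d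
        assume "b \<in> nb a \<and> ((mates s)(x := 0)) a = 0 \<and> ((mates s)(x := 0)) b \<noteq> 0 \<and>
          ((mates s)(x := 0)) b \<noteq> b \<and> d \<in> nb (((mates s)(x := 0)) b) \<and> ((mates s)(x := 0)) d = 0 \<and> a \<noteq> d"
        then show "a \<in> {x} \<or> d \<in> {x}"
          using no_short3[OF ns, of b a d] by (auto split: if_splits)
      qed
      show "mates u w \<noteq> w" if "w \<in> nb x" for w
        using alive[OF that] wf_nbD[OF wf that] unfolding mu by simp
      fix t assume t: "consistent n h nb t" "no_short nb (mates t) {}" "keeps {3, 4, 5, 6, 7} u t"
        "\<And>w. 0 < w \<Longrightarrow> mates t w = w \<longleftrightarrow> mates u w = w"
      show "Q t"
      proof (rule cont)
        show "consistent n h nb t" "no_short nb (mates t) {}" by fact+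
        show "keeps {3, 4, 5, 6, 7} s t" using keeps_trans[OF ku t(3)] by (rule keeps_mono) simp
        show "mates t w = w \<longleftrightarrow> w \<noteq> x \<and> mates s w = w" if "0 < w" for w
          unfolding t(4)[OF that] mu using that by simp
      qed
    qed
  qed
  then show ?thesis using k x by (simp add: release_def s1_def)
qed

section \<open>Edge changes and their effect on short paths\<close>

definition link :: "nat \<Rightarrow> nat \<Rightarrow> (nat \<Rightarrow> nat set) \<Rightarrow> nat \<Rightarrow> nat set" where
  "link x y nb = nb(x := insert y (nb x), y := insert x (nb y))"

definition unlink :: "nat \<Rightarrow> nat \<Rightarrow> (nat \<Rightarrow> nat set) \<Rightarrow> nat \<Rightarrow> nat set" where
  "unlink x y nb = nb(x := nb x - {y}, y := nb y - {x})"

lemma link_iff: "x \<noteq> y \<Longrightarrow> w \<in> link x y nb v \<longleftrightarrow> w \<in> nb v \<or> v = x \<and> w = y \<or> v = y \<and> w = x"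
  by (auto simp: link_def)

lemma unlink_iff: "x \<noteq> y \<Longrightarrow> w \<in> unlink x y nb v \<longleftrightarrow> w \<in> nb v \<and> \<not> (v = x \<and> w = y \<or> v = y \<and> w = x)"
  by (auto simp: unlink_def)

text \<open>The new edge is not matched, so a short path through it has it as an outer edge, and one
  of its nodes is an end. An unmatched node occurs on an augmenting path only as an end: if
  \<open>x\<close> is unmatched the path ends in \<open>x\<close>, otherwise the end must be
  \<open>y\<close>. One exceptional node suffices.\<close>

lemma no_short_link:
  assumes wf: "wf_nb n nb" and mo: "mates_ok n nb mt" and ns: "no_short nb mt {}" and ne: "x \<noteq> y"
    and x: "0 < x" "x \<le> n" and y: "0 < y" "y \<le> n"
  shows "no_short (link x y nb) mt {if mt x = 0 then x else y}"
proof -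
  let ?s = "if mt x = 0 then x else y"
  have range: "0 < b \<and> b \<le> n" if "b \<in> link x y nb a" for a b
    using that wf_nbD[OF wf, of b a] x y unfolding link_iff[OF ne] by blast
  show ?thesis
    unfolding no_short_def
  proof (intro conjI allI impI)
    fix a d assume "d \<in> link x y nb a \<and> mt a = 0 \<and> mt d = 0"
    then show "a \<in> {?s} \<or> d \<in> {?s}"
      using no_short1[OF ns, of d a] unfolding link_iff[OF ne] by auto
  next
    fix a b d
    assume p: "b \<in> link x y nb a \<and> mt a = 0 \<and> mt b \<noteq> 0 \<and> mt b \<noteq> b \<and> d \<in> link x y nb (mt b) \<and>
      mt d = 0 \<and> a \<noteq> d"
    then have bb: "mt (mt b) = b" "b \<noteq> 0" using mates_okD[OF mo, of b] range[of b a] by blast+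
    show "a \<in> {?s} \<or> d \<in> {?s}"
    proof (cases "b \<in> nb a \<and> d \<in> nb (mt b)")
      case True
      then have "a \<in> {} \<or> d \<in> {}" using no_short3[OF ns, of b a d] p by simp
      then show ?thesis by simp
    next
      case False
      then consider "a = x" "b = y" | "a = y" "b = x" | "mt b = x" "d = y" | "mt b = y" "d = x"
        using p unfolding link_iff[OF ne] by blast
      then show ?thesis using p bb by cases auto
    qed
  qed
qed

lemma no_short_empty: "no_short nb mt {} \<Longrightarrow> no_short nb mt S"
  unfolding no_short_def by blast

lemma no_short_matched: "no_short nb mt {x} \<Longrightarrow> mt x \<noteq> 0 \<Longrightarrow> no_short nb mt {}"
  unfolding no_short_def by (metis empty_iff singletonD)

lemma wf_link:
  assumes "wf_nb n nb" "x \<noteq> y" "0 < x" "x \<le> n" "0 < y" "y \<le> n"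
  shows "wf_nb n (link x y nb)"
  unfolding wf_nb_def link_iff[OF assms(2)] using wf_nbD[OF assms(1)] assms by metis

lemma wf_unlink:
  assumes "wf_nb n nb" "x \<noteq> y"
  shows "wf_nb n (unlink x y nb)"
  unfolding wf_nb_def unlink_iff[OF assms(2)] using wf_nbD[OF assms(1)] by metis

lemma card_Int_insert2: "finite A \<Longrightarrow> y \<notin> A \<Longrightarrow>
    card (insert y A \<inter> F) = (if y \<in> F then card (A \<inter> F) + 1 else card (A \<inter> F))"
  by simp

lemma card_Int_remove2: "y \<in> A \<Longrightarrow> finite A \<Longrightarrow>
    card ((A - {y}) \<inter> F) = (if y \<in> F then card (A \<inter> F) - 1 else card (A \<inter> F))"
proof -
  assume y: "y \<in> A" "finite A"
  have "(A - {y}) \<inter> F = (A \<inter> F) - {y}" by blast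
  then show ?thesis using y by (simp add: card_Diff_singleton_if)
qed

text \<open>The constant in register 9 is imposed by the definition instead of being required of
  \<open>s\<close>: memory starts with zeros, and the first command of an update sets it. Between
  updates no node is hidden.\<close>

definition maintained :: "nat \<Rightarrow> nat \<Rightarrow> (nat \<Rightarrow> nat set) \<Rightarrow> state \<Rightarrow> bool" where
  "maintained n h nb s \<longleftrightarrow> consistent n h nb (s(Reg 9 := 1)) \<and> no_short nb (mates s) {} \<and>
     (\<forall>w>0. mates s w \<noteq> w)"

text \<open>Register 8 tests whether the deleted edge was matched; if it was not, removing it
  creates no augmenting path. The lists are corrected before the two ends are hidden, so neither
  hidden end is a neighbour of the other. After an insertion both ends are tried, as either may be
  the unmatched one.\<close>

definition update_prog :: com where
  "update_prog = Const 9 1 ;; If (RReg 0)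
     (del_half 1 2 ;; del_half 2 1 ;; Mov (RReg 4) (RMate 1) ;; Minus (RReg 8) (RReg 4) (RReg 2) ;;
      Minus (RReg 3) (RReg 2) (RReg 4) ;; Plus (RReg 8) (RReg 8) (RReg 3) ;;
      If (RReg 8) Skip (Mov (RMate 1) (RReg 1) ;; Mov (RMate 2) (RReg 2) ;;
        release 1 ;; try_match 1 ;; release 2 ;; try_match 2))
     (ins_half 1 2 ;; ins_half 2 1 ;; try_match 1 ;; try_match 2)"

lemma maintainedI:
  assumes "consistent n h nb s" "no_short nb (mates s) {}" "\<And>w. 0 < w \<Longrightarrow> mates s w \<noteq> w"
  shows "maintained n h nb s"
proof -
  have "s(Reg 9 := 1) = s" using assms(1) by (auto simp: consistent_def)
  then show ?thesis using assms by (simp add: maintained_def)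
qed

text \<open>This form also admits a matched end, about which nothing need be known: the attempt then
  changes nothing, and the burden passes to the other end of the inserted edge.\<close>

lemma wp_try_match_endpoint:
  assumes iv: "consistent n h nb s" and k: "k < 11" "k \<notin> {3, 4, 5, 6, 7}"
    and x: "s (Reg k) = x" "0 < x" "x \<le> n"
    and ns: "mates s x = 0 \<Longrightarrow> no_short nb (mates s) {x}" and alive: "\<And>w. 0 < w \<Longrightarrow> mates s w \<noteq> w"
    and cont: "\<And>t. consistent n h nb t \<Longrightarrow> (mates s x = 0 \<Longrightarrow> no_short nb (mates t) {}) \<Longrightarrow>
      (mates s x \<noteq> 0 \<Longrightarrow> t = s) \<Longrightarrow>
      keeps {3, 4, 5, 6, 7} s t \<Longrightarrow> (\<And>w. 0 < w \<Longrightarrow> mates t w \<noteq> w) \<Longrightarrow> Q t"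
  shows "wp n h (try_match k) Q s"
proof (cases "mates s x = 0")
  case True
  show ?thesis
  proof (rule wp_try_match[OF iv k x ns[OF True]])
    have "wf_nb n nb" using iv by (simp add: consistent_def)
    then show "mates s w \<noteq> w" if "w \<in> nb x" for w using alive[of w] wf_nbD[of n nb w x] that by blast
    fix t assume "consistent n h nb t" "no_short nb (mates t) {}" "keeps {3, 4, 5, 6, 7} s t"
      "\<And>w. 0 < w \<Longrightarrow> mates t w = w \<longleftrightarrow> mates s w = w"
    then show "Q t" using True alive by (intro cont) simp_all
  qed
next
  case False
  have "Q s" using False iv alive by (intro cont) simp_all
  then show ?thesis using False k x by (simp add: try_match_def mates_def)
qed

lemma wp_main_insert:
  assumes ma: "maintained n h nb s" and op: "s (Reg 0) = 0"
    and x: "s (Reg 1) = x" "0 < x" "x \<le> n" and y: "s (Reg 2) = y" "0 < y" "y \<le> n"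
    and ne: "x \<noteq> y" "y \<notin> nb x" and deg: "card (nb x) < h" "card (nb y) < h"
  shows "wp n h update_prog (maintained n h (link x y nb)) s"
proof -
  define s0 where "s0 = s(Reg 9 := 1)"
  define F where "F = {w. mates s w = 0}"
  have m0: "mates s0 = mates s" by (simp add: s0_def)
  have iv: "consistent n h nb s0" and ns: "no_short nb (mates s) {}" and alive: "\<And>w. 0 < w \<Longrightarrow> mates s w \<noteq> w"
    using ma unfolding maintained_def s0_def by blast+
  have wf: "wf_nb n nb" and sl: "slots n h nb s0" and ct: "counts n nb F s0"
    and mo: "mates_ok n nb (mates s)"
    using iv unfolding consistent_def F_def m0 by blast+
  have r0: "s0 (Reg 1) = x" "s0 (Reg 2) = y" "s0 (Reg 9) = 1" using x y by (simp_all add: s0_def)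
  have fin: "finite (nb w)" for w using wf_nb_finite[OF wf] .
  have xy: "x \<notin> nb y" using ne wf_nbD[OF wf, of x y] by blast
  let ?Q = "maintained n h (link x y nb)"
  let ?T = "wp n h (try_match 1) (wp n h (try_match 2) ?Q)"
  have "wp n h (ins_half 1 2) (wp n h (ins_half 2 1) ?T) s0"
  proof (rule wp_ins_half[OF sl])
    show "s0 (Reg 1) = x" "s0 (Reg 2) = y" "s0 (Reg 9) = 1" "0 < x" "x \<le> n" "0 < y" "y \<le> n"
      "y \<notin> nb x" "finite (nb x)" "card (nb x) < h" by fact+
    fix t assume t: "slots n h (nb(x := insert y (nb x))) t" "mates t = mates s0"
      "\<And>k. t (Reg k) = s0 (Reg k)"
      "\<And>w. t (Cnt w) = (if w = x \<and> mates s0 y = 0 then s0 (Cnt w) + 1 else s0 (Cnt w))"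
    show "wp n h (ins_half 2 1) ?T t"
    proof (rule wp_ins_half[OF t(1)])
      show "t (Reg 2) = y" "t (Reg 1) = x" "t (Reg 9) = 1" using t(3) r0 by simp_all
      show "0 < x" "x \<le> n" "0 < y" "y \<le> n" by fact+
      show "x \<notin> (nb(x := insert y (nb x))) y" "finite ((nb(x := insert y (nb x))) y)"
        "card ((nb(x := insert y (nb x))) y) < h" using xy fin deg ne by simp_all
      fix u assume u: "slots n h ((nb(x := insert y (nb x)))(y := insert x ((nb(x := insert y (nb x))) y))) u"
        "mates u = mates t" "\<And>k. u (Reg k) = t (Reg k)"
        "\<And>w. u (Cnt w) = (if w = y \<and> mates t x = 0 then t (Cnt w) + 1 else t (Cnt w))"
      have su: "slots n h (link x y nb) u" using u(1) ne by (simp add: link_def)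
      have mu: "mates u = mates s" using u(2) t(2) m0 by simp
      have ru: "u (Reg k) = s0 (Reg k)" for k using u(3) t(3) by simp
      have "counts n (link x y nb) F u"
        unfolding counts_def
      proof (intro allI impI)
        fix w assume w: "0 < w \<and> w \<le> n"
        then have c0: "s0 (Cnt w) = card (nb w \<inter> F)" using ct by (simp add: counts_def)
        consider "w = x" | "w = y" | "w \<noteq> x" "w \<noteq> y" by blast
        then show "u (Cnt w) = card (link x y nb w \<inter> F)"
        proof cases
          case 1
          then have "link x y nb w = insert y (nb x)" using ne by (simp add: link_def)
          moreover have "u (Cnt w) = (if y \<in> F then s0 (Cnt w) + 1 else s0 (Cnt w))"
            using 1 ne t(2) m0 by (simp add: u(4) t(4) F_def)
          ultimately show ?thesis using 1 c0 card_Int_insert2[OF fin ne(2), of F] by simp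
        next
          case 2
          then have "link x y nb w = insert x (nb y)" by (simp add: link_def)
          moreover have "u (Cnt w) = (if x \<in> F then s0 (Cnt w) + 1 else s0 (Cnt w))"
            using 2 ne t(2) m0 by (simp add: u(4) t(4) F_def)
          ultimately show ?thesis using 2 c0 card_Int_insert2[OF fin xy, of F] by simp
        next
          case 3
          then show ?thesis using c0 by (simp add: link_def u(4) t(4))
        qed
      qed
      moreover have wfl: "wf_nb n (link x y nb)" using wf_link[OF wf ne(1)] x y by simp
      moreover have "mates_ok n (link x y nb) (mates s)"
        unfolding mates_ok_def link_iff[OF ne(1)] using mates_okD[OF mo] by blast
      ultimately have ivu: "consistent n h (link x y nb) u"
        using su ru[of 9] r0 unfolding consistent_def mu F_def by simp
      have nsu: "no_short (link x y nb) (mates u) {if mates u x = 0 then x else y}"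
        unfolding mu using no_short_link[OF wf mo ns ne(1)] x y by simp
      show "?T u"
      proof (rule wp_try_match_endpoint[OF ivu])
        show "u (Reg 1) = x" "0 < x" "x \<le> n" using ru r0 x by simp_all
        show "mates u x = 0 \<Longrightarrow> no_short (link x y nb) (mates u) {x}" using nsu by simp
        show "0 < w \<Longrightarrow> mates u w \<noteq> w" for w unfolding mu by (rule alive)
        fix v assume v: "consistent n h (link x y nb) v"
          "mates u x = 0 \<Longrightarrow> no_short (link x y nb) (mates v) {}" "mates u x \<noteq> 0 \<Longrightarrow> v = u"
          "keeps {3, 4, 5, 6, 7} u v" "\<And>w. 0 < w \<Longrightarrow> mates v w \<noteq> w"
        \<comment> \<open>Either \<open>x\<close> was unmatched and its attempt removed all short
          paths, or nothing happened and \<open>y\<close> is the exceptional node.\<close>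
        have nsv: "no_short (link x y nb) (mates v) {y}"
          using v(2,3) nsu no_short_empty by (cases "mates u x = 0") auto
        show "wp n h (try_match 2) ?Q v"
        proof (rule wp_try_match_endpoint[OF v(1)])
          show "v (Reg 2) = y" "0 < y" "y \<le> n" using v(4) ru r0 y by (simp_all add: keeps_def)
          show "mates v y = 0 \<Longrightarrow> no_short (link x y nb) (mates v) {y}" by (rule nsv)
          show "0 < w \<Longrightarrow> mates v w \<noteq> w" for w by (rule v(5))
          fix z assume z: "consistent n h (link x y nb) z"
            "mates v y = 0 \<Longrightarrow> no_short (link x y nb) (mates z) {}" "mates v y \<noteq> 0 \<Longrightarrow> z = v"
            "\<And>w. 0 < w \<Longrightarrow> mates z w \<noteq> w"
          \<comment> \<open>If \<open>y\<close> is matched, no augmenting path ends in it, so the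
            tolerated paths do not exist.\<close>
          have "no_short (link x y nb) (mates z) {}"
            using z(2,3) no_short_matched[OF nsv] by (cases "mates v y = 0") auto
          with z(1,4) show "?Q z" by (intro maintainedI)
        qed simp_all
      qed simp_all
    qed simp_all
  qed simp_all
  then show ?thesis using op by (simp add: update_prog_def s0_def)
qed

lemma wp_main_delete:
  assumes ma: "maintained n h nb s" and op: "s (Reg 0) = 1"
    and x: "s (Reg 1) = x" and y: "s (Reg 2) = y" "y \<in> nb x"
  shows "wp n h update_prog (maintained n h (unlink x y nb)) s"
proof -
  define s0 where "s0 = s(Reg 9 := 1)"
  define F where "F = {w. mates s w = 0}"
  have m0: "mates s0 = mates s" by (simp add: s0_def)
  have iv: "consistent n h nb s0" and ns: "no_short nb (mates s) {}" and alive: "\<And>w. 0 < w \<Longrightarrow> mates s w \<noteq> w"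
    using ma unfolding maintained_def s0_def by blast+
  have wf: "wf_nb n nb" and sl: "slots n h nb s0" and ct: "counts n nb F s0"
    and mo: "mates_ok n nb (mates s)"
    using iv unfolding consistent_def F_def m0 by blast+
  have xy: "x \<in> nb y" "0 < x" "x \<le> n" "0 < y" "y \<le> n" and ne: "x \<noteq> y"
    using wf_nbD[OF wf y(2)] by blast+
  have r0: "s0 (Reg 1) = x" "s0 (Reg 2) = y" "s0 (Reg 9) = 1" using x y by (simp_all add: s0_def)
  have fin: "finite (nb w)" for w using wf_nb_finite[OF wf] .
  have wfu: "wf_nb n (unlink x y nb)" using wf_unlink[OF wf ne] .
  let ?nb = "unlink x y nb"
  let ?Q = "maintained n h ?nb"
  let ?U = "Mov (RMate 1) (RReg 1) ;; Mov (RMate 2) (RReg 2) ;;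
        release 1 ;; try_match 1 ;; release 2 ;; try_match 2"
  let ?C = "Mov (RReg 4) (RMate 1) ;; Minus (RReg 8) (RReg 4) (RReg 2) ;;
      Minus (RReg 3) (RReg 2) (RReg 4) ;; Plus (RReg 8) (RReg 8) (RReg 3) ;; If (RReg 8) Skip ?U"
  have "wp n h (del_half 1 2) (wp n h (del_half 2 1) (wp n h ?C ?Q)) s0"
  proof (rule wp_del_half[OF sl])
    show "s0 (Reg 1) = x" "s0 (Reg 2) = y" "s0 (Reg 9) = 1" "0 < x" "x \<le> n" "0 < y" "y \<le> n" by fact+
    fix t assume t: "slots n h (nb(x := nb x - {y})) t" "mates t = mates s0"
      "\<And>k. k \<notin> {3, 8} \<Longrightarrow> t (Reg k) = s0 (Reg k)"
      "\<And>w. t (Cnt w) = (if w = x \<and> mates s0 y = 0 then s0 (Cnt w) - 1 else s0 (Cnt w))"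
    show "wp n h (del_half 2 1) (wp n h ?C ?Q) t"
    proof (rule wp_del_half[OF t(1)])
      show "t (Reg 2) = y" "t (Reg 1) = x" "t (Reg 9) = 1" using t(3) r0 by simp_all
      show "0 < x" "x \<le> n" "0 < y" "y \<le> n" by fact+
      fix u assume u: "slots n h ((nb(x := nb x - {y}))(y := (nb(x := nb x - {y})) y - {x})) u"
        "mates u = mates t" "\<And>k. k \<notin> {3, 8} \<Longrightarrow> u (Reg k) = t (Reg k)"
        "\<And>w. u (Cnt w) = (if w = y \<and> mates t x = 0 then t (Cnt w) - 1 else t (Cnt w))"
      have su: "slots n h ?nb u" using u(1) ne by (simp add: unlink_def)
      have mu: "mates u = mates s" using u(2) t(2) m0 by simp
      have um: "u (Mate w) = mates s w" for w using mu by (metis mates_def)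
      have ru: "k \<notin> {3, 8} \<Longrightarrow> u (Reg k) = s0 (Reg k)" for k using u(3) t(3) by simp
      have cu: "counts n ?nb F u"
        unfolding counts_def
      proof (intro allI impI)
        fix w assume w: "0 < w \<and> w \<le> n"
        then have c0: "s0 (Cnt w) = card (nb w \<inter> F)" using ct by (simp add: counts_def)
        consider "w = x" | "w = y" | "w \<noteq> x" "w \<noteq> y" by blast
        then show "u (Cnt w) = card (?nb w \<inter> F)"
        proof cases
          case 1
          then have "?nb w = nb x - {y}" using ne by (simp add: unlink_def)
          moreover have "u (Cnt w) = (if y \<in> F then s0 (Cnt w) - 1 else s0 (Cnt w))"
            using 1 ne t(2) m0 by (simp add: u(4) t(4) F_def)
          ultimately show ?thesis using 1 c0 card_Int_remove2[OF y(2) fin, of F] by simp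
        next
          case 2
          then have "?nb w = nb y - {x}" by (simp add: unlink_def)
          moreover have "u (Cnt w) = (if x \<in> F then s0 (Cnt w) - 1 else s0 (Cnt w))"
            using 2 ne t(2) m0 by (simp add: u(4) t(4) F_def)
          ultimately show ?thesis using 2 c0 card_Int_remove2[OF xy(1) fin, of F] by simp
        next
          case 3
          then show ?thesis using c0 by (simp add: unlink_def u(4) t(4))
        qed
      qed
      \<comment> \<open>The mates are still the old ones, and a smaller graph has fewer candidates
        for short paths.\<close>
      have nsn: "no_short ?nb (mates s) {}"
        unfolding no_short_def unlink_iff[OF ne] using no_short1[OF ns] no_short3[OF ns] by blast
      define d where "d = mates s x - y + (y - mates s x)"
      define v where "v = u(Reg 4 := mates s x, Reg 3 := y - mates s x, Reg 8 := d)"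
      have e: "u(Reg 4 := mates s x, Reg 8 := mates s x - y, Reg 3 := y - mates s x, Reg 8 := d) = v"
        by (rule ext) (simp add: v_def)
      have kv: "keeps {3, 4, 8} u v" by (simp add: v_def keeps_upd)
      have sv: "slots n h ?nb v" by (rule slots_keeps[OF su kv])
      have cv: "counts n ?nb F v" by (rule counts_cong[OF cu]) (simp add: v_def)
      have mv: "mates v = mates s" by (simp add: v_def mu)
      have rv: "v (Reg 1) = x" "v (Reg 2) = y" "v (Reg 9) = 1" "v (Reg 8) = d"
        using ru[of 1] ru[of 2] ru[of 9] r0 by (simp_all add: v_def)
      have "wp n h (If (RReg 8) Skip ?U) ?Q v"
      proof (cases "mates s x = y")
        case False
        then have "d \<noteq> 0" unfolding d_def by linarith
        have "mates s y \<noteq> x"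
          using False mates_okD[OF mo xy(4,5)] xy(2) ne by auto
        then have "mates_ok n ?nb (mates s)"
          unfolding mates_ok_def unlink_iff[OF ne] using False mates_okD[OF mo] by metis
        then have "consistent n h ?nb v" using wfu sv cv rv unfolding consistent_def mv F_def by simp
        then have "?Q v" by (rule maintainedI) (use nsn alive mv in simp_all)
        then show ?thesis using rv \<open>d \<noteq> 0\<close> by simp
      next
        case True
        then have "d = 0" by (simp add: d_def)
        have myx: "mates s y = x" using mates_okD[OF mo xy(2,3)] True ne xy by auto
        define v1 where "v1 = v(Mate x := x, Mate y := y)"
        have mv1: "mates v1 = (mates s)(x := x, y := y)" by (simp add: v1_def mv)
        have kv1: "keeps {} v v1" by (simp add: v1_def keeps_upd)
        have cv1: "counts n ?nb F v1" by (rule counts_cong[OF cv]) (simp add: v1_def)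
        \<comment> \<open>Hiding replaces one nonzero mate by another, so the set of unmatched
          nodes, and with it every counter, stays correct.\<close>
        have F1: "{w. mates v1 w = 0} = F"
          unfolding mv1 F_def using True myx xy by auto
        have "mates_ok n ?nb (mates v1)"
          unfolding mates_ok_def
        proof (intro allI impI)
          fix z assume z: "0 < z \<and> z \<le> n \<and> mates v1 z \<noteq> 0 \<and> mates v1 z \<noteq> z"
          then have zn: "z \<noteq> x" "z \<noteq> y" using ne by (auto simp: mv1)
          then have m: "mates s z \<in> nb z" "mates s (mates s z) = z"
            using mates_okD[OF mo, of z] z alive[of z] by (auto simp: mv1)
          then have "mates s z \<noteq> x" "mates s z \<noteq> y" using True myx zn by auto
          then show "mates v1 z \<in> ?nb z \<and> mates v1 (mates v1 z) = z"
            using m zn by (simp add: mv1 unlink_iff[OF ne])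
        qed
        then have iv1: "consistent n h ?nb v1"
          using wfu slots_keeps[OF sv kv1] cv1 rv unfolding consistent_def F1 by (simp add: v1_def)
        \<comment> \<open>Hiding two nodes makes no node unmatched and only removes a possible
          middle edge.\<close>
        have ns1: "no_short ?nb (mates v1) {}"
          unfolding no_short_def
        proof (intro conjI allI impI)
          fix a d assume "d \<in> ?nb a \<and> mates v1 a = 0 \<and> mates v1 d = 0"
          then show "a \<in> {} \<or> d \<in> {}"
            using no_short1[OF nsn, of d a] xy unfolding mv1 by (auto split: if_splits)
        next
          fix a b d
          assume "b \<in> ?nb a \<and> mates v1 a = 0 \<and> mates v1 b \<noteq> 0 \<and> mates v1 b \<noteq> b \<and>
            d \<in> ?nb (mates v1 b) \<and> mates v1 d = 0 \<and> a \<noteq> d"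
          then show "a \<in> {} \<or> d \<in> {}"
            using no_short3[OF nsn, of b a d] xy unfolding mv1 by (auto split: if_splits)
        qed
        have dead1: "mates v1 w = w \<longleftrightarrow> w = x \<or> w = y" if "0 < w" for w
          using alive[OF that] unfolding mv1 by simp
        have "wp n h (release 1) (wp n h (try_match 1) (wp n h (release 2) (wp n h (try_match 2) ?Q))) v1"
        proof (rule wp_rematch[OF iv1])
          show "v1 (Reg 1) = x" "0 < x" "x \<le> n" using rv xy by (simp_all add: v1_def)
          show "no_short ?nb (mates v1) {}" by (rule ns1)
          show "mates v1 x = x" by (simp add: mv1 ne)
          \<comment> \<open>The only other hidden node is \<open>y\<close>, which is no longer a
            neighbour of \<open>x\<close>.\<close>
          show "mates v1 w \<noteq> w" if "w \<in> ?nb x" for w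
            using dead1[of w] wf_nbD[OF wfu that] that unlink_iff[OF ne, of w nb x] by blast
          fix p assume p: "consistent n h ?nb p" "no_short ?nb (mates p) {}" "keeps {3, 4, 5, 6, 7} v1 p"
            "\<And>w. 0 < w \<Longrightarrow> mates p w = w \<longleftrightarrow> w \<noteq> x \<and> mates v1 w = w"
          have deadp: "mates p w = w \<longleftrightarrow> w = y" if "0 < w" for w
            using p(4)[OF that] dead1[OF that] ne by blast
          show "wp n h (release 2) (wp n h (try_match 2) ?Q) p"
          proof (rule wp_rematch[OF p(1)])
            show "p (Reg 2) = y" "0 < y" "y \<le> n" using p(3) rv xy by (simp_all add: keeps_def v1_def)
            show "no_short ?nb (mates p) {}" by (rule p(2))
            show "mates p y = y" using deadp[of y] xy by simp
            show "mates p w \<noteq> w" if "w \<in> ?nb y" for w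
              using deadp[of w] wf_nbD[OF wfu that] by blast
            fix q assume q: "consistent n h ?nb q" "no_short ?nb (mates q) {}"
              "\<And>w. 0 < w \<Longrightarrow> mates q w = w \<longleftrightarrow> w \<noteq> y \<and> mates p w = w"
            show "?Q q" using q(1,2)
            proof (rule maintainedI)
              show "mates q w \<noteq> w" if "0 < w" for w using q(3)[OF that] deadp[OF that] by blast
            qed
          qed simp_all
        qed simp_all
        then show ?thesis using rv \<open>d = 0\<close> xy by (simp add: v1_def)
      qed
      moreover define W where "W = wp n h (If (RReg 8) Skip ?U) ?Q"
      ultimately have "W v" by simp
      moreover have "wp n h ?C ?Q = wp n h (Mov (RReg 4) (RMate 1))
        (wp n h (Minus (RReg 8) (RReg 4) (RReg 2)) (wp n h (Minus (RReg 3) (RReg 2) (RReg 4))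
        (wp n h (Plus (RReg 8) (RReg 8) (RReg 3)) W)))"
        by (simp only: W_def wp.simps(2))
      ultimately show "wp n h ?C ?Q u"
        using ru[of 1] ru[of 2] r0 xy um e by (simp add: d_def)
    qed simp_all
  qed simp_all
  then show ?thesis using op by (simp add: update_prog_def s0_def)
qed

section \<open>Graphs, runs and the main result\<close>

definition nb_of :: "nat set set \<Rightarrow> nat \<Rightarrow> nat set" where
  "nb_of E x = {y. 0 < x \<and> 0 < y \<and> {x - 1, y - 1} \<in> E}"

definition wf_edges :: "nat \<Rightarrow> nat set set \<Rightarrow> bool" where
  "wf_edges n E \<longleftrightarrow> (\<forall>u v. {u, v} \<in> E \<longrightarrow> u < n \<and> v < n \<and> u \<noteq> v) \<and> (\<forall>e\<in>E. \<exists>u v. e = {u, v})"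

lemma wf_edgesD: "wf_edges n E \<Longrightarrow> {u, v} \<in> E \<Longrightarrow> u < n \<and> v < n \<and> u \<noteq> v"
  unfolding wf_edges_def by blast

lemma nb_of_Suc: "Suc v \<in> nb_of E (Suc u) \<longleftrightarrow> {u, v} \<in> E"
  by (simp add: nb_of_def)

lemma nb_ofE:
  assumes "y \<in> nb_of E x"
  obtains u v where "x = Suc u" "y = Suc v" "{u, v} \<in> E"
  using assms unfolding nb_of_def by (cases x; cases y) auto

lemma wf_nb_of:
  assumes "wf_edges n E" shows "wf_nb n (nb_of E)"
  unfolding wf_nb_def
proof (intro allI impI)
  fix x y assume "y \<in> nb_of E x"
  then obtain u v where uv: "x = Suc u" "y = Suc v" "{u, v} \<in> E" by (rule nb_ofE)
  have "{v, u} \<in> E" using uv(3) by (simp add: insert_commute)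
  then show "x \<in> nb_of E y \<and> 0 < x \<and> x \<le> n \<and> x \<noteq> y"
    using uv wf_edgesD[OF assms uv(3)] by (simp add: nb_of_Suc)
qed

lemma nb_of_insert:
  assumes "u \<noteq> v"
  shows "nb_of (insert {u, v} E) = link (Suc u) (Suc v) (nb_of E)"
proof (intro ext set_eqI)
  have ne: "Suc u \<noteq> Suc v" using assms by simp
  fix x y
  show "y \<in> nb_of (insert {u, v} E) x \<longleftrightarrow> y \<in> link (Suc u) (Suc v) (nb_of E) x"
    unfolding link_iff[OF ne] by (cases x; cases y) (auto simp: nb_of_def doubleton_eq_iff)
qed

lemma nb_of_delete:
  assumes "u \<noteq> v"
  shows "nb_of (E - {{u, v}}) = unlink (Suc u) (Suc v) (nb_of E)"
proof (intro ext set_eqI)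
  have ne: "Suc u \<noteq> Suc v" using assms by simp
  fix x y
  show "y \<in> nb_of (E - {{u, v}}) x \<longleftrightarrow> y \<in> unlink (Suc u) (Suc v) (nb_of E) x"
    unfolding unlink_iff[OF ne] by (cases x; cases y) (auto simp: nb_of_def doubleton_eq_iff)
qed

text \<open>Mapping a neighbour to the edge that joins it to \<open>u\<close> is a bijection onto
  the incident edges, because every edge is a pair.\<close>

lemma card_nb_of:
  assumes "wf_edges n E"
  shows "card (nb_of E (Suc u)) = degree E u"
proof -
  have "inj_on (\<lambda>y. {u, y - 1}) (nb_of E (Suc u))"
  proof (rule inj_onI)
    fix y z assume "y \<in> nb_of E (Suc u)" "z \<in> nb_of E (Suc u)" "{u, y - 1} = {u, z - 1}"
    then have "0 < y" "0 < z" "y - 1 = z - 1" by (auto simp: nb_of_def doubleton_eq_iff)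
    then show "y = z" by linarith
  qed
  moreover have "(\<lambda>y. {u, y - 1}) ` nb_of E (Suc u) = {e \<in> E. u \<in> e}"
  proof (intro set_eqI iffI)
    fix e assume "e \<in> (\<lambda>y. {u, y - 1}) ` nb_of E (Suc u)"
    then show "e \<in> {e \<in> E. u \<in> e}" by (auto simp: nb_of_def)
  next
    fix e assume e: "e \<in> {e \<in> E. u \<in> e}"
    then obtain a b where ab: "e = {a, b}" using assms unfolding wf_edges_def by blast
    then obtain v where v: "e = {u, v}" using e by auto
    then have "Suc v \<in> nb_of E (Suc u)" using e by (simp add: nb_of_Suc)
    then show "e \<in> (\<lambda>y. {u, y - 1}) ` nb_of E (Suc u)" using v by (intro image_eqI[of _ _ "Suc v"]) simp_all
  qed
  ultimately show ?thesis unfolding degree_def by (metis card_image)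
qed

lemma rep_mate: "rep n s m \<Longrightarrow> u < n \<Longrightarrow> m (4 + u) = mates s (Suc u)"
  using rep_at[of n s m "Mate (Suc u)"] by (simp add: scale_def mates_def)

text \<open>The mate function is a symmetric partial matching without hidden nodes, so an edge of
  the decoded set is determined by either of its nodes. Path lengths are odd, so a path shorter than
  five has length one or three, the two patterns that \<open>no_short\<close> excludes.\<close>

lemma good_matching_decode:
  assumes wf: "wf_edges n E" and r: "rep n s m" and ma: "maintained n h (nb_of E) s"
  shows "good_matching E (decode_matching n m)"
proof -
  define M where "M = decode_matching n m"
  have mo: "mates_ok n (nb_of E) (mates s)" and ns: "no_short (nb_of E) (mates s) {}"
    and alive: "\<And>w. 0 < w \<Longrightarrow> mates s w \<noteq> w"
    using ma unfolding maintained_def consistent_def by simp_all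
  have mate: "{u, v} \<in> E \<and> v < n \<and> mates s (Suc v) = Suc u" if uv: "u < n" "mates s (Suc u) = Suc v" for u v
  proof -
    have "Suc v \<in> nb_of E (Suc u) \<and> mates s (Suc v) = Suc u"
      using mates_okD[OF mo, of "Suc u"] alive[of "Suc u"] uv by simp
    then show ?thesis using wf_edgesD[OF wf, of u v] by (simp add: nb_of_Suc)
  qed
  have M_iff: "e \<in> M \<longleftrightarrow> (\<exists>u v. e = {u, v} \<and> u < n \<and> v < n \<and> mates s (Suc u) = Suc v)" for e
    unfolding M_def decode_matching_def by (simp add: rep_mate[OF r] cong: conj_cong)
  \<comment> \<open>An edge was decoded from one of its nodes; symmetry of the mates lets it be read
    from the other one as well.\<close>
  have M_at: "\<exists>v. e = {w, v} \<and> w < n \<and> mates s (Suc w) = Suc v" if e: "e \<in> M" "w \<in> e" for e w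
  proof -
    obtain u v where uv: "e = {u, v}" "u < n" "v < n" "mates s (Suc u) = Suc v"
      using e(1) unfolding M_iff by blast
    then consider "w = u" | "w = v" using e(2) by blast
    then show ?thesis
    proof cases
      case 1 then show ?thesis using uv by blast
    next
      case 2
      moreover have "e = {v, u}" using uv(1) by blast
      ultimately show ?thesis using uv(3) mate[OF uv(2,4)] by blast
    qed
  qed
  have matching: "matching M"
    unfolding matching_def
  proof (intro ballI impI)
    fix e f assume ef: "e \<in> M" "f \<in> M" "e \<noteq> f"
    show "e \<inter> f = {}"
    proof (rule ccontr)
      assume "e \<inter> f \<noteq> {}"
      then obtain w where w: "w \<in> e" "w \<in> f" by blast
      obtain v where v: "e = {w, v}" "mates s (Suc w) = Suc v" using M_at[OF ef(1) w(1)] by blast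
      obtain v' where v': "f = {w, v'}" "mates s (Suc w) = Suc v'" using M_at[OF ef(2) w(2)] by blast
      show False using v v' ef(3) by simp
    qed
  qed
  have sub: "M \<subseteq> E" using mate unfolding M_iff[abs_def] by (metis M_iff subsetI)
  have unmatched: "mates s (Suc x) = 0" if "\<not> matched M x" "x < n" for x
  proof (rule ccontr)
    assume "mates s (Suc x) \<noteq> 0"
    then obtain v where v: "mates s (Suc x) = Suc v" using not0_implies_Suc by blast
    then have "{x, v} \<in> M" using mate[OF that(2) v] that(2) unfolding M_iff by blast
    then show False using that(1) unfolding matched_def by blast
  qed
  have "5 \<le> path_length p" if p: "augmenting_path E M p" for p
  proof (rule ccontr)
    assume "\<not> 5 \<le> path_length p"
    then have len: "length p - 1 < 5" "odd (length p - 1)" "length p \<ge> 2"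
      using p unfolding augmenting_path_def path_length_def by auto
    have e: "{p ! i, p ! Suc i} \<in> E" "{p ! i, p ! Suc i} \<in> M \<longleftrightarrow> odd i" if "i < length p - 1" for i
      using p that unfolding augmenting_path_def by blast+
    have ends: "\<not> matched M (hd p)" "\<not> matched M (last p)" and dist: "distinct p"
      using p unfolding augmenting_path_def by blast+
    have "length p = 2 \<or> length p = 3 \<or> length p = 4 \<or> length p = 5" using len(1,3) by linarith
    then have "length p = 2 \<or> length p = 4" using len(2) by auto
    then show False
    proof
      assume l: "length p = 2"
      then obtain a d where pd: "p = [a, d]" by (auto simp: length_Suc_conv numeral_eq_Suc)
      have ad: "{a, d} \<in> E" using e(1)[of 0] by (simp add: pd)
      then have "mates s (Suc a) = 0" "mates s (Suc d) = 0"
        using unmatched ends wf_edgesD[OF wf ad] by (simp_all add: pd)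
      then show False using no_short1[OF ns, of "Suc d" "Suc a"] ad by (simp add: nb_of_Suc)
    next
      assume l: "length p = 4"
      then obtain a b c d where pd: "p = [a, b, c, d]" by (auto simp: length_Suc_conv numeral_eq_Suc)
      have ab: "{a, b} \<in> E" using e(1)[of 0] by (simp add: pd)
      have bc: "{b, c} \<in> M" using e(2)[of 1] by (simp add: pd)
      have cd: "{c, d} \<in> E" using e(1)[of 2] by (simp add: pd)
      have ad: "mates s (Suc a) = 0" "mates s (Suc d) = 0"
        using unmatched ends wf_edgesD[OF wf ab] wf_edgesD[OF wf cd] by (simp_all add: pd)
      \<comment> \<open>The middle edge is matched, so \<open>c\<close> is the mate of
        \<open>b\<close> and the path has the form that \<open>no_short3\<close> forbids.\<close>
      obtain c' where c': "{b, c} = {b, c'}" "mates s (Suc b) = Suc c'" using M_at[OF bc, of b] by blast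
      then have "mates s (Suc b) = Suc c" by (auto simp: doubleton_eq_iff)
      then show False
        using no_short3[OF ns, of "Suc b" "Suc a" "Suc d"] ab cd ad alive[of "Suc b"] dist
        by (simp add: nb_of_Suc pd)
    qed
  qed
  then show ?thesis using matching sub unfolding good_matching_def M_def by blast
qed

section \<open>The initial state and the transfer of the arguments\<close>

lemma maintained_empty: "maintained n h (\<lambda>_. {}) (\<lambda>_. 0)"
  by (auto simp: maintained_def consistent_def wf_nb_def slots_def counts_def mates_ok_def no_short_def mates_def)

lemma maintained_Reg:
  assumes "maintained n h nb s"
  shows "maintained n h nb (s(Reg k := v))"
proof -
  have i: "consistent n h nb (s(Reg 9 := 1))" using assms by (simp add: maintained_def)
  have k: "keeps {k} (s(Reg 9 := 1)) (s(Reg k := v, Reg 9 := 1))" by (simp add: keeps_def)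
  have sl: "slots n h nb (s(Reg k := v, Reg 9 := 1))"
    by (rule slots_keeps[OF _ k]) (use i in \<open>simp only: consistent_def\<close>)
  have "counts n nb {y. mates s y = 0} (s(Reg 9 := 1))" using i by (simp only: consistent_def mates_upd)
  then have "counts n nb {y. mates s y = 0} (s(Reg k := v, Reg 9 := 1))"
    by (rule counts_cong) simp
  then have "consistent n h nb (s(Reg k := v, Reg 9 := 1))"
    using i sl unfolding consistent_def mates_upd by simp
  then show ?thesis using assms by (simp add: maintained_def)
qed

text \<open>The update arrives in the scratch cells, so it must be saved to registers before any
  generated code runs; the endpoints are shifted by one on the way. Storing needs cell 0 for
  addresses, which destroys the kind of update, so the kind is supplied again as the literal
  \<open>b\<close>.\<close>

definition load_args :: "nat \<Rightarrow> instr list" where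
  "load_args b = [LoadC 0 1, Add 1 1 0, Add 2 2 0] @ [LoadC 0 (7 + 1), Add 0 0 3, StoreI 0 1] @
     [LoadC 0 (7 + 2), Add 0 0 3, StoreI 0 2] @ [LoadC 1 b] @ [LoadC 0 (7 + 0), Add 0 0 3, StoreI 0 1]"

text \<open>Each copy of \<open>load_args\<close> has 13 instructions: the second one begins at
  position 15 and the update itself at 28.\<close>

definition prologue :: "instr list" where
  "prologue = [Jz 0 15] @ load_args 1 @ [Jmp 28] @ load_args 0"

definition program :: "instr list" where
  "program = prologue @ compile 28 update_prog"

lemma rep_store_reg:
  assumes "rep n s m" "k < 11" "c = 1 \<or> c = 2"
  shows "rep n (s(Reg k := m c)) (effects [LoadC 0 (7 + k), Add 0 0 3, StoreI 0 c] m)"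
    and "a = 1 \<or> a = 2 \<Longrightarrow> effects [LoadC 0 (7 + k), Add 0 0 3, StoreI 0 c] m a = m a"
proof -
  have r: "rep n s (m(0 := 7 + n + k))" using rep_scratch[OF assms(1)] by simp
  have e: "effects [LoadC 0 (7 + k), Add 0 0 3, StoreI 0 c] m = m(0 := 7 + n + k, 7 + n + k := m c)"
    using rep_n[OF assms(1)] assms(3) by auto
  show "rep n (s(Reg k := m c)) (effects [LoadC 0 (7 + k), Add 0 0 3, StoreI 0 c] m)"
    unfolding e using rep_upd[OF r, of "Reg k" "m c" "m c"] assms(2) by (simp add: scale_def)
  show "a = 1 \<or> a = 2 \<Longrightarrow> effects [LoadC 0 (7 + k), Add 0 0 3, StoreI 0 c] m a = m a"
    unfolding e by auto
qed

lemma rep_load_args: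
  assumes "rep n s m"
  shows "rep n (s(Reg 0 := b, Reg 1 := Suc (m 1), Reg 2 := Suc (m 2))) (effects (load_args b) m)"
proof -
  define m1 where "m1 = effects [LoadC 0 1, Add 1 1 0, Add 2 2 0] m"
  have m1: "rep n s m1" "m1 1 = Suc (m 1)" "m1 2 = Suc (m 2)"
    using assms by (simp_all add: m1_def rep_scratch)
  define m2 where "m2 = effects [LoadC 0 (7 + 1), Add 0 0 3, StoreI 0 1] m1"
  have m2: "rep n (s(Reg 1 := Suc (m 1))) m2" "m2 2 = Suc (m 2)"
    using rep_store_reg[OF m1(1), of 1 1] m1 unfolding m2_def by simp_all
  define m3 where "m3 = effects [LoadC 0 (7 + 2), Add 0 0 3, StoreI 0 2] m2"
  have m3: "rep n (s(Reg 1 := Suc (m 1), Reg 2 := Suc (m 2))) m3"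
    using rep_store_reg(1)[OF m2(1), of 2 2] m2(2) unfolding m3_def by simp
  define m4 where "m4 = effects [LoadC 1 b] m3"
  have m4: "rep n (s(Reg 1 := Suc (m 1), Reg 2 := Suc (m 2))) m4" "m4 1 = b"
    using m3 by (simp_all add: m4_def rep_scratch)
  have "rep n (s(Reg 1 := Suc (m 1), Reg 2 := Suc (m 2), Reg 0 := b))
      (effects [LoadC 0 (7 + 0), Add 0 0 3, StoreI 0 1] m4)"
    using rep_store_reg(1)[OF m4(1), of 0 1] m4(2) by simp
  moreover have "s(Reg 1 := Suc (m 1), Reg 2 := Suc (m 2), Reg 0 := b) =
    s(Reg 0 := b, Reg 1 := Suc (m 1), Reg 2 := Suc (m 2))"
    by (rule ext) simp
  ultimately show ?thesis
    unfolding load_args_def effects_append m1_def m2_def m3_def m4_def by simp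
qed

lemma length_load_args: "length (load_args b) = 13"
  by (simp add: load_args_def)

lemma exec_prologue:
  assumes "rep n s m" "m 0 = b" "b = 0 \<or> b = 1"
  shows "\<exists>t m'. t \<le> 15 \<and> exec program t (0, m) = (28, m') \<and>
    rep n (s(Reg 0 := b, Reg 1 := Suc (m 1), Reg 2 := Suc (m 2))) m'"
proof -
  have "code_at program 0 ([Jz 0 15] @ load_args 1 @ [Jmp 28] @ load_args 0 @ compile 28 update_prog)"
    unfolding code_at_def program_def prologue_def by (intro exI[of _ "[]"]) simp
  note c1 = code_at_append[OF this]
  note c2 = code_at_append[OF c1(2)]
  note c3 = code_at_append[OF c2(2)]
  note c4 = code_at_append[OF c3(2)]
  have cd: "code_at program 0 [Jz 0 15]" "code_at program 1 (load_args 1)" "code_at program 14 [Jmp 28]"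
    "code_at program 15 (load_args 0)"
    using c1(1) c2(1) c3(1) c4(1) by (simp_all add: length_load_args)
  have st: "list_all straight (load_args b)" for b by (simp add: load_args_def)
  show ?thesis
  proof (cases "b = 0")
    case True
    have "exec program (1 + 13) (0, m) = (15 + 13, effects (load_args 0) m)"
      using exec_comp[OF exec_Jz[OF cd(1), of m], of 13] exec_straight[OF cd(4) st, of m] True assms(2)
      by (simp add: length_load_args)
    then show ?thesis using rep_load_args[OF assms(1), of 0] True
      by (intro exI[of _ "14"] exI[of _ "effects (load_args 0) m"]) simp
  next
    case False
    then have b: "b = 1" using assms(3) by simp
    have "exec program (1 + 13) (0, m) = (1 + 13, effects (load_args 1) m)"
      using exec_comp[OF exec_Jz[OF cd(1), of m], of 13] exec_straight[OF cd(2) st, of m] b assms(2)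
      by (simp add: length_load_args)
    from exec_comp[OF this, of 1] exec_Jmp[OF cd(3), of "effects (load_args 1) m"]
    have "exec program 15 (0, m) = (28, effects (load_args 1) m)" by simp
    then show ?thesis using rep_load_args[OF assms(1), of 1] b
      by (intro exI[of _ "15"] exI[of _ "effects (load_args 1) m"]) simp
  qed
qed

lemma program_correct:
  assumes n: "0 < n" and r: "rep n s m" and b: "m 0 = b" "b = 0 \<or> b = 1"
    and w: "wp n h update_prog Q (s(Reg 0 := b, Reg 1 := Suc (m 1), Reg 2 := Suc (m 2)))"
  shows "\<exists>m' s'. halts_within program (15 + cost h update_prog) m m' \<and> rep n s' m' \<and> Q s'"
proof -
  obtain t1 m1 where 1: "t1 \<le> 15" "exec program t1 (0, m) = (28, m1)"
    "rep n (s(Reg 0 := b, Reg 1 := Suc (m 1), Reg 2 := Suc (m 2))) m1"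
    using exec_prologue[OF r b] by blast
  have len: "length prologue = 28" by (simp add: prologue_def length_load_args)
  have "code_at program 28 (compile 28 update_prog)"
    unfolding code_at_def program_def by (intro exI[of _ prologue] exI[of _ "[]"]) (simp add: len)
  from compile_correct[OF n this 1(3) w]
  obtain t2 m2 s2 where 2: "t2 \<le> cost h update_prog" "exec program t2 (28, m1) = (28 + clen update_prog, m2)"
    "rep n s2 m2" "Q s2" by blast
  have e: "exec program (t1 + t2) (0, m) = (28 + clen update_prog, m2)" using exec_comp[OF 1(2) 2(2)] .
  \<comment> \<open>The program has no \<open>Halt\<close>; running past its last instruction counts
    as halting.\<close>
  have "length program = 28 + clen update_prog" by (simp add: program_def len)
  then have "halts_within program (15 + cost h update_prog) m m2"
    unfolding halts_within_def using 1(1) 2(1) e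
    by (intro exI[of _ "t1 + t2"]) (simp add: halted_def)
  then show ?thesis using 2(3,4) by blast
qed

lemma update_correct:
  assumes wf: "wf_edges n E" and v: "valid_update n E up"
    and deg: "\<And>x. x < n \<Longrightarrow> degree (apply_update E up) x \<le> \<Delta>"
    and r: "rep n s m" and ma: "maintained n \<Delta> (nb_of E) s"
  shows "wf_edges n (apply_update E up)"
    and "\<exists>m' s'. halts_within program (15 + cost \<Delta> update_prog) (write_update up m) m' \<and> rep n s' m' \<and>
      maintained n \<Delta> (nb_of (apply_update E up)) s'"
proof -
  have upd: "rep n s (m(0 := a, 1 := b, 2 := c))" for a b c
    by (intro rep_scratch r) simp_all
  have wfa: "wf_edges n (apply_update E up)"
  proof (cases up)
    case (Ins u v)
    then show ?thesis using wf v unfolding wf_edges_def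
      by (auto simp: doubleton_eq_iff)
  next
    case (Del u v)
    then have "apply_update E up \<subseteq> E" by auto
    then show ?thesis using wf unfolding wf_edges_def by blast
  qed
  then show "wf_edges n (apply_update E up)" .
  show "\<exists>m' s'. halts_within program (15 + cost \<Delta> update_prog) (write_update up m) m' \<and> rep n s' m' \<and>
      maintained n \<Delta> (nb_of (apply_update E up)) s'"
  proof (cases up)
    case (Ins u w)
    have uw: "u < n" "w < n" "u \<noteq> w" "{u, w} \<notin> E" using v Ins by simp_all
    have link: "nb_of (apply_update E up) = link (Suc u) (Suc w) (nb_of E)"
      using nb_of_insert[OF uw(3)] Ins by simp
    have fin: "finite (nb_of E x)" for x using wf_nb_finite[OF wf_nb_of[OF wf]] .
    have new: "Suc w \<notin> nb_of E (Suc u)" "Suc u \<notin> nb_of E (Suc w)"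
      using uw(4) by (simp_all add: nb_of_Suc insert_commute)
    \<comment> \<open>The degree bound is used for the graph after the insertion. Without the new
      neighbour the old degrees are strictly below \<open>\<Delta>\<close>, which is what a free
      slot requires.\<close>
    have "card (link (Suc u) (Suc w) (nb_of E) (Suc x)) \<le> \<Delta>" if "x < n" for x
      using deg[OF that] card_nb_of[OF wfa, of x] link by simp
    from this[OF uw(1)] this[OF uw(2)]
    have c: "card (nb_of E (Suc u)) < \<Delta>" "card (nb_of E (Suc w)) < \<Delta>"
      using uw(3) new fin by (simp_all add: link_def)
    let ?m = "m(0 := 0, 1 := u, 2 := w)"
    have "wp n \<Delta> update_prog (maintained n \<Delta> (link (Suc u) (Suc w) (nb_of E)))
      (s(Reg 0 := 0, Reg 1 := Suc (?m 1), Reg 2 := Suc (?m 2)))"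
      by (rule wp_main_insert) (use ma uw c new in \<open>simp_all add: maintained_Reg\<close>)
    then have "\<exists>m' s'. halts_within program (15 + cost \<Delta> update_prog) ?m m' \<and> rep n s' m' \<and>
        maintained n \<Delta> (link (Suc u) (Suc w) (nb_of E)) s'"
      by (rule program_correct[OF _ upd, rotated -1]) (use uw(1) in simp_all)
    then show ?thesis unfolding link unfolding Ins write_update.simps .
  next
    case (Del u w)
    have e: "{u, w} \<in> E" using v Del by simp
    note uw = wf_edgesD[OF wf e]
    have ne: "u \<noteq> w" using uw by simp
    have unlink: "nb_of (apply_update E up) = unlink (Suc u) (Suc w) (nb_of E)"
      using nb_of_delete[OF ne] Del by simp
    let ?m = "m(0 := 1, 1 := u, 2 := w)"
    have "wp n \<Delta> update_prog (maintained n \<Delta> (unlink (Suc u) (Suc w) (nb_of E)))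
      (s(Reg 0 := 1, Reg 1 := Suc (?m 1), Reg 2 := Suc (?m 2)))"
      by (rule wp_main_delete) (use ma e in \<open>simp_all add: maintained_Reg nb_of_Suc\<close>)
    then have "\<exists>m' s'. halts_within program (15 + cost \<Delta> update_prog) ?m m' \<and> rep n s' m' \<and>
        maintained n \<Delta> (unlink (Suc u) (Suc w) (nb_of E)) s'"
      by (rule program_correct[OF _ upd, rotated -1]) (use uw in simp_all)
    then show ?thesis unfolding unlink unfolding Del write_update.simps .
  qed
qed

section \<open>Sequences of updates and the uniform constant\<close>

lemma valid_updates_snoc:
  assumes "valid_updates n \<Delta> (us @ [up])"
  shows "valid_updates n \<Delta> us" "valid_update n (graph_after us) up"
    "x < n \<Longrightarrow> degree (apply_update (graph_after us) up) x \<le> \<Delta>"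
proof -
  have v: "valid_update n (graph_after (take i (us @ [up]))) ((us @ [up]) ! i)" if "i \<le> length us" for i
    using assms that unfolding valid_updates_def by simp
  have d: "degree (graph_after (take i (us @ [up]))) x \<le> \<Delta>" if "i \<le> Suc (length us)" "x < n" for i x
    using assms that unfolding valid_updates_def by simp
  show "valid_updates n \<Delta> us"
    unfolding valid_updates_def
  proof (intro conjI allI impI)
    fix i assume "i < length us"
    then show "valid_update n (graph_after (take i us)) (us ! i)" using v[of i] by (simp add: nth_append)
  next
    fix i x assume "i \<le> length us" "x < n"
    then show "degree (graph_after (take i us)) x \<le> \<Delta>" using d[of i x] by simp
  qed
  show "valid_update n (graph_after us) up" using v[of "length us"] by simp
  show "x < n \<Longrightarrow> degree (apply_update (graph_after us) up) x \<le> \<Delta>"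
    using d[of "Suc (length us)" x] by (simp add: graph_after_def)
qed

lemma rep_init: "rep n (\<lambda>_. 0) (init_mem n)"
  using addr_ge unfolding rep_def init_mem_def by fastforce

text \<open>The claim is strengthened by an abstract state for the last memory. The induction adds
  updates at the end, as the list of memories grows there.\<close>

lemma run_updates:
  assumes "valid_updates n \<Delta> us"
  shows "\<exists>mems s. length mems = Suc (length us) \<and> mems ! 0 = init_mem n \<and>
    (\<forall>i < length us.
       halts_within program (15 + cost \<Delta> update_prog) (write_update (us ! i) (mems ! i)) (mems ! Suc i) \<and>
       good_matching (graph_after (take (Suc i) us)) (decode_matching n (mems ! Suc i))) \<and>
    rep n s (mems ! length us) \<and> wf_edges n (graph_after us) \<and> maintained n \<Delta> (nb_of (graph_after us)) s"
  using assms
proof (induction us rule: rev_induct)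
  case Nil
  have "nb_of {} = (\<lambda>_. {})" by (auto simp: nb_of_def)
  then show ?case using rep_init maintained_empty
    by (intro exI[of _ "[init_mem n]"] exI[of _ "\<lambda>_. 0"]) (simp add: graph_after_def wf_edges_def)
next
  case (snoc up us)
  note v = valid_updates_snoc[OF snoc.prems]
  obtain mems s where len: "length mems = Suc (length us)" and init: "mems ! 0 = init_mem n"
    and steps: "\<And>i. i < length us \<Longrightarrow>
       halts_within program (15 + cost \<Delta> update_prog) (write_update (us ! i) (mems ! i)) (mems ! Suc i) \<and>
       good_matching (graph_after (take (Suc i) us)) (decode_matching n (mems ! Suc i))"
    and r: "rep n s (mems ! length us)" and wf: "wf_edges n (graph_after us)"
    and ma: "maintained n \<Delta> (nb_of (graph_after us)) s"
    using snoc.IH[OF v(1)] by blast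
  define E where "E = graph_after (us @ [up])"
  have E: "apply_update (graph_after us) up = E" by (simp add: E_def graph_after_def)
  note u = update_correct[OF wf v(2,3) r ma, unfolded E]
  from u(2) obtain m' s' where
    m': "halts_within program (15 + cost \<Delta> update_prog) (write_update up (mems ! length us)) m'" "rep n s' m'"
      "maintained n \<Delta> (nb_of E) s'" by blast
  have good: "good_matching E (decode_matching n m')"
    by (rule good_matching_decode[OF u(1) m'(2,3)])
  let ?mems = "mems @ [m']"
  have "halts_within program (15 + cost \<Delta> update_prog) (write_update ((us @ [up]) ! i) (?mems ! i)) (?mems ! Suc i) \<and>
       good_matching (graph_after (take (Suc i) (us @ [up]))) (decode_matching n (?mems ! Suc i))"
    if "i < length (us @ [up])" for i
  proof (cases "i = length us")
    case True
    then show ?thesis using m'(1) good len by (simp add: nth_append E_def)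
  next
    case False
    then have "i < length us" using that by simp
    then show ?thesis using steps[of i] len by (simp add: nth_append)
  qed
  moreover have "length ?mems = Suc (length (us @ [up]))" "?mems ! 0 = init_mem n"
    "rep n s' (?mems ! length (us @ [up]))"
    using len init m'(2) by (simp_all add: nth_append)
  ultimately show ?case using u(1) m'(3) unfolding E_def by blast
qed

lemma cost_main: "\<exists>k. \<forall>h. cost h update_prog \<le> k * (h + 1)"
  by (rule cost_linear)
    (simp add: update_prog_def del_half_def ins_half_def try_match_def release_def bump_def search_def find_free_def)

lemma halts_within_mono: "halts_within P k m m' \<Longrightarrow> k \<le> l \<Longrightarrow> halts_within P l m m'"
  unfolding halts_within_def using le_trans by blast

theorem theorem3p4:
  shows "\<exists>(P :: instr list) (c :: nat). \<forall>n \<Delta> us. valid_updates n \<Delta> us \<longrightarrow>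
    (\<exists>mems :: (nat \<Rightarrow> nat) list. length mems = Suc (length us) \<and>
       mems ! 0 = init_mem n \<and>
       (\<forall>i < length us.
          halts_within P (c * (\<Delta> + 1)) (write_update (us ! i) (mems ! i)) (mems ! Suc i) \<and>
          good_matching (graph_after (take (Suc i) us)) (decode_matching n (mems ! Suc i))))"
proof -
  obtain k where k: "\<And>h. cost h update_prog \<le> k * (h + 1)" using cost_main by blast
  \<comment> \<open>The 15 accounts for the prologue. The factor \<open>h + 1\<close> instead of
    \<open>h\<close> absorbs constant costs even for degree bound 0.\<close>
  have bound: "15 + cost h update_prog \<le> (15 + k) * (h + 1)" for h
    using k[of h] by (simp add: add_mult_distrib)
  show ?thesis
  proof (intro exI[of _ program] exI[of _ "15 + k"] allI impI)
    fix n \<Delta> us assume "valid_updates n \<Delta> us"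
    from run_updates[OF this] obtain mems where mems: "length mems = Suc (length us)" "mems ! 0 = init_mem n"
      "\<forall>i < length us.
         halts_within program (15 + cost \<Delta> update_prog) (write_update (us ! i) (mems ! i)) (mems ! Suc i) \<and>
         good_matching (graph_after (take (Suc i) us)) (decode_matching n (mems ! Suc i))" by blast
    then show "\<exists>mems :: (nat \<Rightarrow> nat) list. length mems = Suc (length us) \<and> mems ! 0 = init_mem n \<and>
       (\<forall>i < length us.
          halts_within program ((15 + k) * (\<Delta> + 1)) (write_update (us ! i) (mems ! i)) (mems ! Suc i) \<and>
          good_matching (graph_after (take (Suc i) us)) (decode_matching n (mems ! Suc i)))"
      using halts_within_mono[OF _ bound] by blast
  qed
qed

end
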